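(* Let $T_\triangle$ be the theory of the Henson graph. There exist a model $M\models T_\triangle$ and a formula $\varphi(x;b)$ which strictly divides over $M$ but does not universally strictly divide over $M$. Consequently $T_\triangle$ does not satisfy New Kim's Lemma.
   Context: The Henson graph is the Fraïssé limit of the class of finite triangle-free graphs (language: one binary edge relation $R$); $T_\triangle$ is its complete theory. Work in a monster model $\mathbb{M}$. A formula divides over $M$ if it divides along some $M$-indiscernible sequence in the type of its parameters; it forks if it implies a finite disjunction of dividing formulas; $A\mathop{\smile\!\!\!\!\!\mid}^f_M B$ means $\mathrm{tp}(A/MB)$ contains no formula forking over $M$. A global type $q$ is $M$-invariant if for all $\varphi(x;y)$ and $c\equiv_M c'$, $\varphi(x;c)\in q$ iff $\varphi(x;c')\in q$; a Morley sequence over $M$ for $q$ is $(b_i)_{i<\omega}$ with $b_i\models q|_{Mb_{<i}}$; $\varphi(x;b)$ divides along it if $\{\varphi(x;b_i)\}$ is inconsistent. A global $M$-invariant type $p$ is strict invariant if for all sets $B$ and $a\models p|_{MB}$, $B\mathop{\smile\!\!\!\!\!\mid}^f_M a$. $\varphi(x;b)$ strictly divides over $M$ if it divides along a Morley sequence for some global strict $M$-invariant type extending $\mathrm{tp}(b/M)$, and universally strictly divides if it divides along Morley sequences for every such type. Kim-dividing, Kim-forking, $\mathop{\smile\!\!\!\!\!\mid}^K$, Kim-strict types and universal Kim-strict dividing are defined analogously with "Kim-divides over $M$" (divides along a Morley sequence for some global $M$-invariant extension of $\mathrm{tp}(b/M)$) in place of "divides". New Kim's Lemma: for all models $M$, every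 formula Kim-dividing over $M$ universally Kim-strictly divides over $M$. *)

theory Defs
  imports Main "HOL-Library.Countable_Set"
begin

unbundle cardinal_syntax

section \<open>First-order logic with one binary relation symbol\<close>

datatype fm =
    Eq nat nat
  | Adj nat nat
  | Neg fm
  | Conj fm fm
  | Exi nat fm

fun fv :: "fm \<Rightarrow> nat set" where
  "fv (Eq i j) = {i, j}"
| "fv (Adj i j) = {i, j}"
| "fv (Neg \<phi>) = fv \<phi>"
| "fv (Conj \<phi> \<psi>) = fv \<phi> \<union> fv \<psi>"
| "fv (Exi i \<phi>) = fv \<phi> - {i}"

text \<open>A structure is a universe \<open>U\<close> together with a relation \<open>R\<close>, of which only the
  restriction to \<open>U\<close> matters.\<close>

fun sat :: "'a set \<Rightarrow> ('a \<Rightarrow> 'a \<Rightarrow> bool) \<Rightarrow> (nat \<Rightarrow> 'a) \<Rightarrow> fm \<Rightarrow> bool" where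
  "sat U R v (Eq i j) \<longleftrightarrow> v i = v j"
| "sat U R v (Adj i j) \<longleftrightarrow> R (v i) (v j)"
| "sat U R v (Neg \<phi>) \<longleftrightarrow> \<not> sat U R v \<phi>"
| "sat U R v (Conj \<phi> \<psi>) \<longleftrightarrow> sat U R v \<phi> \<and> sat U R v \<psi>"
| "sat U R v (Exi i \<phi>) \<longleftrightarrow> (\<exists>a\<in>U. sat U R (v(i := a)) \<phi>)"

definition theory_of :: "'a set \<Rightarrow> ('a \<Rightarrow> 'a \<Rightarrow> bool) \<Rightarrow> fm set" where
  "theory_of U R = {\<sigma>. fv \<sigma> = {} \<and> (\<forall>v. range v \<subseteq> U \<longrightarrow> sat U R v \<sigma>)}"

definition models :: "'a set \<Rightarrow> ('a \<Rightarrow> 'a \<Rightarrow> bool) \<Rightarrow> fm set \<Rightarrow> bool" where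
  "models U R T \<longleftrightarrow> U \<noteq> {} \<and> (\<forall>\<sigma>\<in>T. \<forall>v. range v \<subseteq> U \<longrightarrow> sat U R v \<sigma>)"

definition elem_sub :: "'a set \<Rightarrow> 'a set \<Rightarrow> ('a \<Rightarrow> 'a \<Rightarrow> bool) \<Rightarrow> bool" where
  "elem_sub M U R \<longleftrightarrow> M \<noteq> {} \<and> M \<subseteq> U \<and>
     (\<forall>\<phi> v. range v \<subseteq> M \<longrightarrow> (sat M R v \<phi> \<longleftrightarrow> sat U R v \<phi>))"


section \<open>The Henson graph\<close>

definition embedding ::
  "('a \<Rightarrow> 'b) \<Rightarrow> 'a set \<Rightarrow> ('a \<Rightarrow> 'a \<Rightarrow> bool) \<Rightarrow> 'b set \<Rightarrow> ('b \<Rightarrow> 'b \<Rightarrow> bool) \<Rightarrow> bool" where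
  "embedding f U R V S \<longleftrightarrow> inj_on f U \<and> f ` U \<subseteq> V \<and> (\<forall>x\<in>U. \<forall>y\<in>U. R x y \<longleftrightarrow> S (f x) (f y))"

definition isomorphism ::
  "('a \<Rightarrow> 'b) \<Rightarrow> 'a set \<Rightarrow> ('a \<Rightarrow> 'a \<Rightarrow> bool) \<Rightarrow> 'b set \<Rightarrow> ('b \<Rightarrow> 'b \<Rightarrow> bool) \<Rightarrow> bool" where
  "isomorphism f U R V S \<longleftrightarrow> bij_betw f U V \<and> (\<forall>x\<in>U. \<forall>y\<in>U. R x y \<longleftrightarrow> S (f x) (f y))"

text \<open>Every finite structure has an isomorphic copy whose universe is a set of natural numbers,
  so isomorphism-closed classes of finite structures (such as ages) are represented by their
  members on finite sets of natural numbers.\<close>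

definition in_age ::
  "'a set \<Rightarrow> ('a \<Rightarrow> 'a \<Rightarrow> bool) \<Rightarrow> nat set \<Rightarrow> (nat \<Rightarrow> nat \<Rightarrow> bool) \<Rightarrow> bool" where
  "in_age U R V S \<longleftrightarrow> finite V \<and> (\<exists>f. embedding f V S U R)"

definition ultrahomogeneous :: "'a set \<Rightarrow> ('a \<Rightarrow> 'a \<Rightarrow> bool) \<Rightarrow> bool" where
  "ultrahomogeneous U R \<longleftrightarrow>
     (\<forall>A B f. finite A \<and> A \<subseteq> U \<and> B \<subseteq> U \<and> isomorphism f A R B R \<longrightarrow>
        (\<exists>g. isomorphism g U R U R \<and> (\<forall>a\<in>A. g a = f a)))"

definition fraisse_limit ::
  "(nat set \<Rightarrow> (nat \<Rightarrow> nat \<Rightarrow> bool) \<Rightarrow> bool) \<Rightarrow> 'a set \<Rightarrow> ('a \<Rightarrow> 'a \<Rightarrow> bool) \<Rightarrow> bool" where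
  "fraisse_limit K U R \<longleftrightarrow>
     countable U \<and> (\<forall>V S. in_age U R V S \<longleftrightarrow> K V S) \<and> ultrahomogeneous U R"

definition finite_triangle_free_graph :: "'a set \<Rightarrow> ('a \<Rightarrow> 'a \<Rightarrow> bool) \<Rightarrow> bool" where
  "finite_triangle_free_graph V S \<longleftrightarrow> finite V \<and>
     (\<forall>x\<in>V. \<not> S x x) \<and> (\<forall>x\<in>V. \<forall>y\<in>V. S x y \<longrightarrow> S y x) \<and>
     \<not> (\<exists>x\<in>V. \<exists>y\<in>V. \<exists>z\<in>V. S x y \<and> S y z \<and> S x z)"

definition henson_graph :: "'a set \<Rightarrow> ('a \<Rightarrow> 'a \<Rightarrow> bool) \<Rightarrow> bool" where
  "henson_graph U R \<longleftrightarrow> fraisse_limit finite_triangle_free_graph U R"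


section \<open>Types and the monster model\<close>

text \<open>From here on \<open>E\<close> is the relation of a fixed structure whose universe is the whole type
  \<open>'a\<close>. Finite tuples are lists. A formula \<open>\<phi>(x;c)\<close> with \<open>n\<close> free variables
  \<open>x\<close> and parameter tuple \<open>c\<close> is a pair \<open>(\<phi>, c)\<close>: the variables \<open>0, \<dots>, n - 1\<close> of
  \<open>\<phi>\<close> stand for \<open>x\<close>, and the variables \<open>n, \<dots>, n + length c - 1\<close> are evaluated at \<open>c\<close>.\<close>

type_synonym 'a pfm = "fm \<times> 'a list"

definition formulas_over :: "nat \<Rightarrow> 'a set \<Rightarrow> 'a pfm set" where
  "formulas_over n A = {(\<phi>, c). set c \<subseteq> A \<and> fv \<phi> \<subseteq> {..<n + length c}}"

definition holds :: "('a \<Rightarrow> 'a \<Rightarrow> bool) \<Rightarrow> 'a list \<Rightarrow> 'a pfm \<Rightarrow> bool" where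
  "holds E a = (\<lambda>(\<phi>, c). sat UNIV E (\<lambda>i. (a @ c) ! i) \<phi>)"

text \<open>By compactness, consistency with the elementary diagram of the structure is finite
  satisfiability in it.\<close>

definition consistent :: "('a \<Rightarrow> 'a \<Rightarrow> bool) \<Rightarrow> nat \<Rightarrow> 'a pfm set \<Rightarrow> bool" where
  "consistent E n \<Sigma> \<longleftrightarrow>
     (\<forall>F. finite F \<and> F \<subseteq> \<Sigma> \<longrightarrow> (\<exists>a. length a = n \<and> (\<forall>\<theta>\<in>F. holds E a \<theta>)))"

definition complete_type :: "('a \<Rightarrow> 'a \<Rightarrow> bool) \<Rightarrow> nat \<Rightarrow> 'a set \<Rightarrow> 'a pfm set \<Rightarrow> bool" where
  "complete_type E n A p \<longleftrightarrow> p \<subseteq> formulas_over n A \<and> consistent E n p \<and>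
     (\<forall>(\<phi>, c)\<in>formulas_over n A. (\<phi>, c) \<in> p \<or> (Neg \<phi>, c) \<in> p)"

definition tp :: "('a \<Rightarrow> 'a \<Rightarrow> bool) \<Rightarrow> 'a list \<Rightarrow> 'a set \<Rightarrow> 'a pfm set" where
  "tp E a A = {\<theta> \<in> formulas_over (length a) A. holds E a \<theta>}"

definition equiv_over :: "('a \<Rightarrow> 'a \<Rightarrow> bool) \<Rightarrow> 'a set \<Rightarrow> 'a list \<Rightarrow> 'a list \<Rightarrow> bool" where
  "equiv_over E A a b \<longleftrightarrow> length a = length b \<and> tp E a A = tp E b A"

definition realizes_restriction ::
  "('a \<Rightarrow> 'a \<Rightarrow> bool) \<Rightarrow> nat \<Rightarrow> 'a pfm set \<Rightarrow> 'a set \<Rightarrow> 'a list \<Rightarrow> bool" where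
  "realizes_restriction E n q A a \<longleftrightarrow>
     length a = n \<and> (\<forall>\<theta>\<in>q \<inter> formulas_over n A. holds E a \<theta>)"

definition saturated :: "'k rel \<Rightarrow> ('a \<Rightarrow> 'a \<Rightarrow> bool) \<Rightarrow> bool" where
  "saturated \<kappa> E \<longleftrightarrow>
     (\<forall>A n p. |A| <o \<kappa> \<and> complete_type E n A p \<longrightarrow>
        (\<exists>a. length a = n \<and> (\<forall>\<theta>\<in>p. holds E a \<theta>)))"

definition strongly_homogeneous :: "'k rel \<Rightarrow> ('a \<Rightarrow> 'a \<Rightarrow> bool) \<Rightarrow> bool" where
  "strongly_homogeneous \<kappa> E \<longleftrightarrow>
     (\<forall>A f. |A| <o \<kappa> \<and> (\<forall>a. set a \<subseteq> A \<longrightarrow> equiv_over E {} a (map f a)) \<longrightarrow>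
        (\<exists>g. isomorphism g UNIV E UNIV E \<and> (\<forall>a\<in>A. g a = f a)))"

definition monster_model :: "'k rel \<Rightarrow> fm set \<Rightarrow> ('a \<Rightarrow> 'a \<Rightarrow> bool) \<Rightarrow> bool" where
  "monster_model \<kappa> T E \<longleftrightarrow> Card_order \<kappa> \<and> natLeq <o \<kappa> \<and>
     models UNIV E T \<and> saturated \<kappa> E \<and> strongly_homogeneous \<kappa> E"

text \<open>As usual, models are small elementary substructures of the monster model.\<close>

definition small_model :: "'k rel \<Rightarrow> ('a \<Rightarrow> 'a \<Rightarrow> bool) \<Rightarrow> 'a set \<Rightarrow> bool" where
  "small_model \<kappa> E M \<longleftrightarrow> |M| <o \<kappa> \<and> elem_sub M UNIV E"


section \<open>Forking and strict dividing\<close>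

definition divides_along :: "('a \<Rightarrow> 'a \<Rightarrow> bool) \<Rightarrow> nat \<Rightarrow> fm \<Rightarrow> (nat \<Rightarrow> 'a list) \<Rightarrow> bool" where
  "divides_along E n \<phi> s \<longleftrightarrow> \<not> consistent E n (range (\<lambda>i. (\<phi>, s i)))"

definition indiscernible :: "('a \<Rightarrow> 'a \<Rightarrow> bool) \<Rightarrow> 'a set \<Rightarrow> (nat \<Rightarrow> 'a list) \<Rightarrow> bool" where
  "indiscernible E M s \<longleftrightarrow>
     (\<forall>I J. length I = length J \<and> sorted_wrt (<) I \<and> sorted_wrt (<) J \<longrightarrow>
        equiv_over E M (concat (map s I)) (concat (map s J)))"

definition divides :: "('a \<Rightarrow> 'a \<Rightarrow> bool) \<Rightarrow> 'a set \<Rightarrow> nat \<Rightarrow> 'a pfm \<Rightarrow> bool" where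
  "divides E M n = (\<lambda>(\<phi>, b).
     \<exists>s. indiscernible E M s \<and> (\<forall>i. equiv_over E M (s i) b) \<and> divides_along E n \<phi> s)"

definition implies_disj :: "('a \<Rightarrow> 'a \<Rightarrow> bool) \<Rightarrow> nat \<Rightarrow> 'a pfm \<Rightarrow> 'a pfm set \<Rightarrow> bool" where
  "implies_disj E n \<theta> \<Psi> \<longleftrightarrow>
     (\<forall>a. length a = n \<and> holds E a \<theta> \<longrightarrow> (\<exists>\<psi>\<in>\<Psi>. holds E a \<psi>))"

definition forks :: "('a \<Rightarrow> 'a \<Rightarrow> bool) \<Rightarrow> 'a set \<Rightarrow> nat \<Rightarrow> 'a pfm \<Rightarrow> bool" where
  "forks E M n \<theta> \<longleftrightarrow>
     (\<exists>\<Psi>. finite \<Psi> \<and> \<Psi> \<subseteq> formulas_over n UNIV \<and> (\<forall>\<psi>\<in>\<Psi>. divides E M n \<psi>) \<and>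
        implies_disj E n \<theta> \<Psi>)"

text \<open>A formula of \<open>tp(A/MB)\<close>, for a possibly infinite set \<open>A\<close>, involves only the variables
  of some finite tuple \<open>a\<close> from \<open>A\<close>.\<close>

definition indep_f :: "('a \<Rightarrow> 'a \<Rightarrow> bool) \<Rightarrow> 'a set \<Rightarrow> 'a set \<Rightarrow> 'a set \<Rightarrow> bool" where
  "indep_f E M A B \<longleftrightarrow>
     (\<forall>a. set a \<subseteq> A \<longrightarrow> (\<forall>\<theta>\<in>tp E a (M \<union> B). \<not> forks E M (length a) \<theta>))"

definition global_invariant_type ::
  "('a \<Rightarrow> 'a \<Rightarrow> bool) \<Rightarrow> 'a set \<Rightarrow> nat \<Rightarrow> 'a pfm set \<Rightarrow> bool" where
  "global_invariant_type E M n q \<longleftrightarrow> complete_type E n UNIV q \<and>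
     (\<forall>\<phi> c c'. fv \<phi> \<subseteq> {..<n + length c} \<and> equiv_over E M c c' \<longrightarrow>
        ((\<phi>, c) \<in> q \<longleftrightarrow> (\<phi>, c') \<in> q))"

definition morley_sequence ::
  "('a \<Rightarrow> 'a \<Rightarrow> bool) \<Rightarrow> 'a set \<Rightarrow> nat \<Rightarrow> 'a pfm set \<Rightarrow> (nat \<Rightarrow> 'a list) \<Rightarrow> bool" where
  "morley_sequence E M n q s \<longleftrightarrow>
     (\<forall>i. realizes_restriction E n q (M \<union> (\<Union>j<i. set (s j))) (s i))"

text \<open>Both independence relations have finite character in \<open>B\<close>, so it makes no difference
  in the next definition and in its Kim variant whether \<open>B\<close> is required to be small.\<close>

definition strict_invariant ::
  "('a \<Rightarrow> 'a \<Rightarrow> bool) \<Rightarrow> 'a set \<Rightarrow> nat \<Rightarrow> 'a pfm set \<Rightarrow> bool" where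
  "strict_invariant E M n p \<longleftrightarrow> global_invariant_type E M n p \<and>
     (\<forall>B a. realizes_restriction E n p (M \<union> B) a \<longrightarrow> indep_f E M B (set a))"

definition strictly_divides :: "('a \<Rightarrow> 'a \<Rightarrow> bool) \<Rightarrow> 'a set \<Rightarrow> nat \<Rightarrow> 'a pfm \<Rightarrow> bool" where
  "strictly_divides E M n = (\<lambda>(\<phi>, b).
     \<exists>q s. strict_invariant E M (length b) q \<and> tp E b M \<subseteq> q \<and>
       morley_sequence E M (length b) q s \<and> divides_along E n \<phi> s)"

definition universally_strictly_divides ::
  "('a \<Rightarrow> 'a \<Rightarrow> bool) \<Rightarrow> 'a set \<Rightarrow> nat \<Rightarrow> 'a pfm \<Rightarrow> bool" where
  "universally_strictly_divides E M n = (\<lambda>(\<phi>, b).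
     \<forall>q s. strict_invariant E M (length b) q \<and> tp E b M \<subseteq> q \<and>
       morley_sequence E M (length b) q s \<longrightarrow> divides_along E n \<phi> s)"


section \<open>Kim-forking and New Kim's Lemma\<close>

definition kim_divides :: "('a \<Rightarrow> 'a \<Rightarrow> bool) \<Rightarrow> 'a set \<Rightarrow> nat \<Rightarrow> 'a pfm \<Rightarrow> bool" where
  "kim_divides E M n = (\<lambda>(\<phi>, b).
     \<exists>q s. global_invariant_type E M (length b) q \<and> tp E b M \<subseteq> q \<and>
       morley_sequence E M (length b) q s \<and> divides_along E n \<phi> s)"

definition kim_forks :: "('a \<Rightarrow> 'a \<Rightarrow> bool) \<Rightarrow> 'a set \<Rightarrow> nat \<Rightarrow> 'a pfm \<Rightarrow> bool" where
  "kim_forks E M n \<theta> \<longleftrightarrow>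
     (\<exists>\<Psi>. finite \<Psi> \<and> \<Psi> \<subseteq> formulas_over n UNIV \<and> (\<forall>\<psi>\<in>\<Psi>. kim_divides E M n \<psi>) \<and>
        implies_disj E n \<theta> \<Psi>)"

definition indep_K :: "('a \<Rightarrow> 'a \<Rightarrow> bool) \<Rightarrow> 'a set \<Rightarrow> 'a set \<Rightarrow> 'a set \<Rightarrow> bool" where
  "indep_K E M A B \<longleftrightarrow>
     (\<forall>a. set a \<subseteq> A \<longrightarrow> (\<forall>\<theta>\<in>tp E a (M \<union> B). \<not> kim_forks E M (length a) \<theta>))"

definition kim_strict_invariant ::
  "('a \<Rightarrow> 'a \<Rightarrow> bool) \<Rightarrow> 'a set \<Rightarrow> nat \<Rightarrow> 'a pfm set \<Rightarrow> bool" where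
  "kim_strict_invariant E M n p \<longleftrightarrow> global_invariant_type E M n p \<and>
     (\<forall>B a. realizes_restriction E n p (M \<union> B) a \<longrightarrow> indep_K E M B (set a))"

definition universally_kim_strictly_divides ::
  "('a \<Rightarrow> 'a \<Rightarrow> bool) \<Rightarrow> 'a set \<Rightarrow> nat \<Rightarrow> 'a pfm \<Rightarrow> bool" where
  "universally_kim_strictly_divides E M n = (\<lambda>(\<phi>, b).
     \<forall>q s. kim_strict_invariant E M (length b) q \<and> tp E b M \<subseteq> q \<and>
       morley_sequence E M (length b) q s \<longrightarrow> divides_along E n \<phi> s)"

definition new_kims_lemma :: "'k rel \<Rightarrow> ('a \<Rightarrow> 'a \<Rightarrow> bool) \<Rightarrow> bool" where
  "new_kims_lemma \<kappa> E \<longleftrightarrow>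
     (\<forall>M n \<theta>. small_model \<kappa> E M \<and> \<theta> \<in> formulas_over n UNIV \<and> kim_divides E M n \<theta> \<longrightarrow>
        universally_kim_strictly_divides E M n \<theta>)"

end

theory Submission
  imports Defs "HOL-Library.Countable_Set_Type"
begin

text \<open>A small model \<open>M\<close> of \<open>T\<^sub>\<triangle>\<close> and \<open>m\<^sub>1 \<noteq> m\<^sub>2\<close> in \<open>M\<close> are fixed, together with non-adjacent \<open>b\<^sub>1\<close>,
  \<open>b\<^sub>2\<close> outside \<open>M\<close> whose only neighbours in \<open>M\<close> are \<open>m\<^sub>1\<close> and \<open>m\<^sub>2\<close>, respectively. The formula is
  \<open>R(x, b\<^sub>1) \<and> R(x, b\<^sub>2)\<close>. The realisations of \<open>tp(b\<^sub>1/M)\<close> have a common neighbour, so they are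
  pairwise non-adjacent, and likewise for \<open>tp(b\<^sub>2/M)\<close>; nothing in \<open>M\<close> is adjacent to
  realisations of both. Hence there is an \<open>M\<close>-invariant type of pairs \<open>(y\<^sub>1, y\<^sub>2)\<close> whose only edges
  to elements outside \<open>M\<close> join \<open>y\<^sub>2\<close> to all realisations of \<open>tp(b\<^sub>1/M)\<close>. In a Morley sequence the
  first coordinate of one pair is adjacent to the second coordinate of the next, so the formula
  divides. In a Morley sequence of the type without any edges to elements outside \<open>M\<close> all
  coordinates are pairwise non-adjacent, so the formula does not divide.

  Both types are strict. If \<open>a\<close> realises one of them over \<open>MB\<close>, then the type of \<open>B\<close> over \<open>Ma\<close>
  extends to a global \<open>M\<close>-invariant type, obtained by the same construction with the roles of the
  two types over \<open>M\<close> exchanged, and formulas in \<open>M\<close>-invariant types neither fork nor Kim-fork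
  over \<open>M\<close>.\<close>

text \<open>The carrier is a parameter, so that the monster model and its submodels both qualify.
  \<open>extension\<close> is the one-point extension property of the Henson graph; with
  \<open>A\<close> and \<open>B\<close> empty it also gives nonemptiness.\<close>

locale generic_triangle_free =
  fixes U :: "'a set" and R :: "'a \<Rightarrow> 'a \<Rightarrow> bool"
  assumes irreflexive: "x \<in> U \<Longrightarrow> \<not> R x x"
    and symmetric: "x \<in> U \<Longrightarrow> y \<in> U \<Longrightarrow> R x y \<Longrightarrow> R y x"
    and triangle_free: "x \<in> U \<Longrightarrow> y \<in> U \<Longrightarrow> z \<in> U \<Longrightarrow> R x y \<Longrightarrow> R y z \<Longrightarrow> \<not> R x z"
    and extension: "finite A \<Longrightarrow> finite B \<Longrightarrow> A \<subseteq> U \<Longrightarrow> B \<subseteq> U \<Longrightarrow> A \<inter> B = {} \<Longrightarrow>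
      (\<And>x y. x \<in> A \<Longrightarrow> y \<in> A \<Longrightarrow> \<not> R x y) \<Longrightarrow>
      \<exists>z\<in>U. z \<notin> A \<union> B \<and> (\<forall>x\<in>A. R z x) \<and> (\<forall>x\<in>B. \<not> R z x)"

section \<open>Elimination of quantifiers\<close>

text \<open>The known object is a partial isomorphism sending \<open>v i\<close> to
  \<open>w i\<close>, the invariant of a back-and-forth argument.\<close>

definition same_atoms ::
  "('a \<Rightarrow> 'a \<Rightarrow> bool) \<Rightarrow> ('b \<Rightarrow> 'b \<Rightarrow> bool) \<Rightarrow> nat set \<Rightarrow> (nat \<Rightarrow> 'a) \<Rightarrow> (nat \<Rightarrow> 'b) \<Rightarrow> bool" where
  "same_atoms R S I v w \<longleftrightarrow>
     (\<forall>i\<in>I. \<forall>j\<in>I. (v i = v j \<longleftrightarrow> w i = w j) \<and> (R (v i) (v j) \<longleftrightarrow> S (w i) (w j)))"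

lemma finite_fv: "finite (fv \<phi>)"
  by (induction \<phi>) auto

lemma same_atoms_commute: "same_atoms R S I v w \<longleftrightarrow> same_atoms S R I w v"
  unfolding same_atoms_def by auto

lemma same_atoms_mono: "same_atoms R S I v w \<Longrightarrow> J \<subseteq> I \<Longrightarrow> same_atoms R S J v w"
  unfolding same_atoms_def by blast

text \<open>The forth step. For a new \<open>a\<close>, its neighbours among the \<open>v i\<close>
  are pairwise non-adjacent, as \<open>U\<close> has no triangles. So are the corresponding
  \<open>w i\<close>, and \<open>extension\<close> in \<open>V\<close> supplies
  \<open>b\<close>.\<close>

lemma same_atoms_extend:
  assumes U: "generic_triangle_free U R" and V: "generic_triangle_free V S"
    and I: "finite I" "v ` I \<subseteq> U" "w ` I \<subseteq> V" "same_atoms R S I v w"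
    and k: "k \<notin> I" and a: "a \<in> U"
  obtains b where "b \<in> V" "same_atoms R S (insert k I) (v(k := a)) (w(k := b))"
proof -
  interpret U: generic_triangle_free U R by (rule U)
  interpret V: generic_triangle_free V S by (rule V)
  have eq: "v i = v j \<longleftrightarrow> w i = w j" and adj: "R (v i) (v j) \<longleftrightarrow> S (w i) (w j)"
    if "i \<in> I" "j \<in> I" for i j
    using I(4) that unfolding same_atoms_def by auto
  have vU: "v i \<in> U" and wV: "w i \<in> V" if "i \<in> I" for i
    using I that by auto
  have goal: "same_atoms R S (insert k I) (v(k := a)) (w(k := b))"
    if "b \<in> V" and "\<And>i. i \<in> I \<Longrightarrow> (v i = a \<longleftrightarrow> w i = b) \<and> (R a (v i) \<longleftrightarrow> S b (w i))" for b
  proof -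
    have "i \<noteq> k" if "i \<in> I" for i
      using k that by blast
    moreover have "R (v i) a \<longleftrightarrow> S (w i) b" if "i \<in> I" for i
      using that \<open>b \<in> V\<close> a vU wV U.symmetric V.symmetric
        \<open>\<And>i. i \<in> I \<Longrightarrow> (v i = a \<longleftrightarrow> w i = b) \<and> (R a (v i) \<longleftrightarrow> S b (w i))\<close> by blast
    moreover have "\<not> R a a" "\<not> S b b"
      using a \<open>b \<in> V\<close> U.irreflexive V.irreflexive by auto
    ultimately show ?thesis
      using that(2) eq adj unfolding same_atoms_def by (auto simp: eq_commute)
  qed
  show thesis
  proof (cases "a \<in> v ` I")
    case True
    then obtain j where j: "j \<in> I" "a = v j" by blast
    have "same_atoms R S (insert k I) (v(k := a)) (w(k := w j))"
      using j eq adj wV by (intro goal) auto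
    then show thesis using that j wV by blast
  next
    case False
    let ?A = "{w i | i. i \<in> I \<and> R a (v i)}" and ?B = "{w i | i. i \<in> I \<and> \<not> R a (v i)}"
    have "\<exists>z\<in>V. z \<notin> ?A \<union> ?B \<and> (\<forall>x\<in>?A. S z x) \<and> (\<forall>x\<in>?B. \<not> S z x)"
    proof (rule V.extension)
      show "?A \<inter> ?B = {}"
        using eq by fastforce
      show "\<not> S x y" if "x \<in> ?A" "y \<in> ?A" for x y
        using that adj U.triangle_free[OF a] vU by blast
    qed (use I wV in auto)
    then obtain z where z: "z \<in> V" "z \<notin> ?A \<union> ?B" "\<forall>x\<in>?A. S z x" "\<forall>x\<in>?B. \<not> S z x"
      by blast
    have "same_atoms R S (insert k I) (v(k := a)) (w(k := z))"
      using z False by (intro goal) blast+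
    then show thesis using that z by blast
  qed
qed

text \<open>Back and forth between two possibly different structures gives quantifier elimination,
  completeness and model completeness at once.\<close>

lemma sat_iff_of_same_atoms:
  assumes "generic_triangle_free U R" and "generic_triangle_free V S"
    and "v ` fv \<phi> \<subseteq> U" "w ` fv \<phi> \<subseteq> V" "same_atoms R S (fv \<phi>) v w"
  shows "sat U R v \<phi> \<longleftrightarrow> sat V S w \<phi>"
  using assms(3-)
proof (induction \<phi> arbitrary: v w)
  case (Eq i j)
  then show ?case by (auto simp: same_atoms_def)
next
  case (Adj i j)
  then show ?case by (auto simp: same_atoms_def)
next
  case (Neg \<phi>)
  then show ?case by simp
next
  case (Conj \<phi> \<psi>)
  have "sat U R v \<phi> \<longleftrightarrow> sat V S w \<phi>"
    using Conj.prems by (intro Conj.IH) (auto intro: same_atoms_mono)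
  moreover have "sat U R v \<psi> \<longleftrightarrow> sat V S w \<psi>"
    using Conj.prems by (intro Conj.IH) (auto intro: same_atoms_mono)
  ultimately show ?case by simp
next
  case (Exi k \<phi>)
  let ?I = "fv \<phi> - {k}"
  have I: "finite ?I" "k \<notin> ?I" by (auto simp: finite_fv)
  have sub: "fv \<phi> \<subseteq> insert k ?I" by blast
  have step: "sat U R (v(k := a)) \<phi> \<longleftrightarrow> sat V S (w(k := b)) \<phi>"
    if "a \<in> U" "b \<in> V" "same_atoms R S (insert k ?I) (v(k := a)) (w(k := b))" for a b
    using that Exi.prems by (intro Exi.IH same_atoms_mono[OF that(3) sub]) auto
  show ?case
  proof
    assume "sat U R v (Exi k \<phi>)"
    then obtain a where a: "a \<in> U" "sat U R (v(k := a)) \<phi>" by auto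
    obtain b where "b \<in> V" "same_atoms R S (insert k ?I) (v(k := a)) (w(k := b))"
      using same_atoms_extend[OF assms(1,2) I(1) _ _ _ I(2) a(1)] Exi.prems by auto
    then show "sat V S w (Exi k \<phi>)" using a step by auto
  next
    assume "sat V S w (Exi k \<phi>)"
    then obtain b where b: "b \<in> V" "sat V S (w(k := b)) \<phi>" by auto
    obtain a where "a \<in> U" "same_atoms S R (insert k ?I) (w(k := b)) (v(k := a))"
      using same_atoms_extend[OF assms(2,1) I(1) _ _ _ I(2) b(1)] Exi.prems
      by (auto simp: same_atoms_commute[of S R])
    then show "sat U R v (Exi k \<phi>)" using b step by (auto simp: same_atoms_commute[of S R])
  qed
qed

section \<open>Countable elementary submodels\<close>

lemma elem_sub_of_generic:
  assumes "generic_triangle_free M R" "generic_triangle_free U R" "M \<subseteq> U"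
  shows "elem_sub M U R"
proof -
  have "M \<noteq> {}"
    using generic_triangle_free.extension[OF assms(1), of "{}" "{}"] by auto
  moreover have "sat M R v \<phi> \<longleftrightarrow> sat U R v \<phi>" if "range v \<subseteq> M" for v \<phi>
    using that assms by (intro sat_iff_of_same_atoms) (auto simp: same_atoms_def)
  ultimately show ?thesis
    using assms(3) by (auto simp: elem_sub_def)
qed

text \<open>A direct Loewenheim-Skolem argument: only the extension property needs care, the other
  axioms being universal. The empty set is closed under a choice of witnesses in countably many
  stages, all of them countable.\<close>

lemma countable_generic_subset:
  assumes "generic_triangle_free U R"
  obtains M where "countable M" "M \<subseteq> U" "generic_triangle_free M R"
proof -
  interpret generic_triangle_free U R by (rule assms)
  define ok where "ok A B \<longleftrightarrow> finite A \<and> finite B \<and> A \<subseteq> U \<and> B \<subseteq> U \<and> A \<inter> B = {} \<and>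
    (\<forall>x\<in>A. \<forall>y\<in>A. \<not> R x y)" for A B
  have "\<exists>z. ok A B \<longrightarrow> z \<in> U \<and> z \<notin> A \<union> B \<and> (\<forall>x\<in>A. R z x) \<and> (\<forall>x\<in>B. \<not> R z x)" for A B
    using extension[of A B] unfolding ok_def by blast
  then obtain w where w: "ok A B \<Longrightarrow>
    w A B \<in> U \<and> w A B \<notin> A \<union> B \<and> (\<forall>x\<in>A. R (w A B) x) \<and> (\<forall>x\<in>B. \<not> R (w A B) x)" for A B
    by metis
  define F where "F X = X \<union> {w A B | A B. ok A B \<and> A \<subseteq> X \<and> B \<subseteq> X}" for X
  define G where "G k = (F ^^ k) {}" for k :: nat
  define M where "M = (\<Union>k. G k)"
  have G_Suc: "G (Suc k) = F (G k)" for k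
    by (simp add: G_def)
  have "countable (F X)" if "countable X" for X
  proof -
    have "{w A B | A B. ok A B \<and> A \<subseteq> X \<and> B \<subseteq> X} \<subseteq>
      (\<lambda>(A, B). w A B) ` ({A. finite A \<and> A \<subseteq> X} \<times> {B. finite B \<and> B \<subseteq> X})"
      by (auto simp: ok_def)
    moreover have "countable {A. finite A \<and> A \<subseteq> X}"
      using countable_Collect_finite_subset[OF that] by (simp add: conj_commute)
    ultimately show ?thesis
      unfolding F_def using that
      by (meson countable_SIGMA countable_Un countable_image countable_subset)
  qed
  then have "countable (G k)" for k
    by (induction k) (auto simp: G_Suc, simp add: G_def)
  then have 1: "countable M"
    by (simp add: M_def)
  have "G k \<subseteq> U" for k
    using w by (induction k) (auto simp: G_Suc F_def, simp add: G_def)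
  then have 2: "M \<subseteq> U"
    by (auto simp: M_def)
  have mono: "G i \<subseteq> G j" if "i \<le> j" for i j
    using that by (rule lift_Suc_mono_le[rotated]) (auto simp: G_Suc F_def)
  \<comment> \<open>The stages increase, so every finite extension problem in \<open>M\<close> lies
    in one stage and is solved in the next.\<close>
  have fin: "\<exists>k. A \<subseteq> G k" if "finite A" "A \<subseteq> M" for A
    using that
  proof (induction A)
    case (insert x A)
    then obtain i j where "A \<subseteq> G i" "x \<in> G j" by (auto simp: M_def)
    then have "insert x A \<subseteq> G (max i j)"
      using mono[of i "max i j"] mono[of j "max i j"] by auto
    then show ?case by blast
  qed auto
  have "generic_triangle_free M R"
  proof
    fix A B assume *: "finite A" "finite B" "A \<subseteq> M" "B \<subseteq> M" "A \<inter> B = {}"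
      "\<And>x y. x \<in> A \<Longrightarrow> y \<in> A \<Longrightarrow> \<not> R x y"
    then obtain k where "A \<union> B \<subseteq> G k" using fin[of "A \<union> B"] by auto
    moreover have "ok A B" using * 2 by (auto simp: ok_def)
    ultimately have "w A B \<in> G (Suc k)" by (auto simp: G_Suc F_def)
    then have "w A B \<in> M" by (auto simp: M_def)
    then show "\<exists>z\<in>M. z \<notin> A \<union> B \<and> (\<forall>x\<in>A. R z x) \<and> (\<forall>x\<in>B. \<not> R z x)"
      using w[OF \<open>ok A B\<close>] by blast
  qed (use 2 irreflexive in blast, use 2 symmetric in blast, use 2 triangle_free in blast)
  then show thesis using that 1 2 by blast
qed

section \<open>The theory of the Henson graph\<close>

text \<open>The syntax has no truth constant; \<open>Exi 0 (Eq 0 0)\<close> is a sentence that holds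
  in every nonempty structure.\<close>

fun conjs :: "fm list \<Rightarrow> fm" where
  "conjs [] = Exi 0 (Eq 0 0)"
| "conjs (\<phi> # \<phi>s) = Conj \<phi> (conjs \<phi>s)"

lemma sat_conjs [simp]: "U \<noteq> {} \<Longrightarrow> sat U R v (conjs \<phi>s) \<longleftrightarrow> (\<forall>\<phi>\<in>set \<phi>s. sat U R v \<phi>)"
  by (induction \<phi>s) auto

fun alls :: "nat \<Rightarrow> fm \<Rightarrow> fm" where
  "alls 0 \<phi> = \<phi>"
| "alls (Suc n) \<phi> = alls n (Neg (Exi n (Neg \<phi>)))"

lemma fv_alls: "fv (alls n \<phi>) = fv \<phi> - {..<n}"
  by (induction n arbitrary: \<phi>) auto

lemma sat_alls: "(\<forall>v. sat UNIV R v (alls n \<phi>)) \<longleftrightarrow> (\<forall>v. sat UNIV R v \<phi>)"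
proof (induction n arbitrary: \<phi>)
  case (Suc n)
  have "(\<forall>v. sat UNIV R v (Neg (Exi n (Neg \<phi>)))) \<longleftrightarrow> (\<forall>v. sat UNIV R v \<phi>)"
    by simp (metis fun_upd_triv)
  with Suc show ?case by simp
qed simp

text \<open>\<open>theory_of\<close> contains only sentences. Passing to a universal closure, which
  is valid exactly when \<open>\<phi>\<close> is, lets open formulas serve as axioms.\<close>

lemma valid_transfer:
  assumes "models UNIV E (theory_of UNIV H)" and "\<And>v. sat UNIV H v \<phi>"
  shows "sat UNIV E v \<phi>"
proof -
  obtain n where n: "fv \<phi> \<subseteq> {..<n}"
    using finite_fv finite_nat_iff_bounded by blast
  have "alls n \<phi> \<in> theory_of UNIV H"
    using n assms(2) sat_alls[of H n \<phi>] by (auto simp: theory_of_def fv_alls)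
  then have "\<forall>v. sat UNIV E v (alls n \<phi>)"
    using assms(1) by (simp add: models_def)
  then show ?thesis by (simp add: sat_alls)
qed

text \<open>Each axiom is written as an open formula valid in \<open>H\<close> and transferred. The
  extension property becomes a scheme, with one formula for each pair of lengths of the lists
  enumerating \<open>A\<close> and \<open>B\<close>.\<close>

lemma generic_of_models:
  assumes T: "models UNIV E (theory_of UNIV H)" and H: "generic_triangle_free UNIV H"
  shows "generic_triangle_free UNIV E"
proof
  interpret H: generic_triangle_free UNIV H by (rule H)
  let ?v = "\<lambda>x y z i. if i = 0 then x else if i = (1::nat) then y else z"
  show "\<not> E x x" for x
    using valid_transfer[OF T, of "Neg (Adj 0 0)" "\<lambda>_. x"] H.irreflexive by auto
  show "E y x" if "E x y" for x y
    using valid_transfer[OF T, of "Neg (Conj (Adj 0 1) (Neg (Adj 1 0)))" "?v x y y"]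
      H.symmetric that by auto
  show "\<not> E x z" if "E x y" "E y z" for x y z
    using valid_transfer[OF T, of "Neg (Conj (Adj 0 1) (Conj (Adj 1 2) (Adj 0 2)))" "?v x y z"]
      H.triangle_free that by auto
  fix A B :: "'a set"
  assume fin: "finite A" "finite B" and disj: "A \<inter> B = {}"
    and indep: "\<And>x y. x \<in> A \<Longrightarrow> y \<in> A \<Longrightarrow> \<not> E x y"
  obtain as bs where ab: "set as = A" "set bs = B"
    using fin finite_list by metis
  \<comment> \<open>The variables below \<open>p\<close> enumerate \<open>A\<close>, those from
    \<open>p\<close> to \<open>n - 1\<close> enumerate \<open>B\<close>, and \<open>n\<close> is the
    witness. Repetitions within one list are harmless, so the only inequalities in
    \<open>prem\<close> separate the two lists.\<close>
  define p n where "p = length as" and "n = length as + length bs"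
  define prem where "prem = conjs
    (map (\<lambda>(i, j). Neg (Adj i j)) (List.product [0..<p] [0..<p]) @
     map (\<lambda>(i, j). Neg (Eq i j)) (List.product [0..<p] [p..<n]))"
  define conc where "conc = conjs (map (\<lambda>i. Adj n i) [0..<p] @
    map (\<lambda>i. Conj (Neg (Adj n i)) (Neg (Eq n i))) [p..<n])"
  have pn: "p \<le> n" by (simp add: p_def n_def)
  have prem: "sat UNIV R v prem \<longleftrightarrow> (\<forall>i<p. \<forall>j<p. \<not> R (v i) (v j)) \<and>
      (\<forall>i<p. \<forall>j\<in>{p..<n}. v i \<noteq> v j)" for R :: "'c \<Rightarrow> 'c \<Rightarrow> bool" and v
    by (auto simp: prem_def ball_Un)
  have conc: "sat UNIV R (v(n := z)) conc \<longleftrightarrow> (\<forall>i<p. R z (v i)) \<and>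
      (\<forall>j\<in>{p..<n}. \<not> R z (v j) \<and> z \<noteq> v j)" for R :: "'c \<Rightarrow> 'c \<Rightarrow> bool" and v z
    using pn by (auto simp: conc_def ball_Un)
  have "sat UNIV H v (Neg (Conj prem (Neg (Exi n conc))))" for v
  proof -
    have "\<exists>z. sat UNIV H (v(n := z)) conc" if "sat UNIV H v prem"
    proof -
      have "\<exists>z\<in>UNIV. z \<notin> v ` {..<p} \<union> v ` {p..<n} \<and> (\<forall>x\<in>v ` {..<p}. H z x) \<and>
          (\<forall>x\<in>v ` {p..<n}. \<not> H z x)"
      proof (rule H.extension)
        show "v ` {..<p} \<inter> v ` {p..<n} = {}"
          using that unfolding prem by blast
        show "\<not> H x y" if "x \<in> v ` {..<p}" "y \<in> v ` {..<p}" for x y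
          using that \<open>sat UNIV H v prem\<close> unfolding prem by blast
      qed auto
      then obtain z where "z \<notin> v ` {..<p} \<union> v ` {p..<n}" "\<forall>x\<in>v ` {..<p}. H z x"
          "\<forall>x\<in>v ` {p..<n}. \<not> H z x" by blast
      then have "sat UNIV H (v(n := z)) conc" unfolding conc by auto
      then show ?thesis by blast
    qed
    then show ?thesis by auto
  qed
  then have E: "sat UNIV E v (Neg (Conj prem (Neg (Exi n conc))))" for v
    by (rule valid_transfer[OF T])
  define u where "u = (\<lambda>i. (as @ bs) ! i)"
  have as: "u i \<in> A" if "i < p" for i
    using that ab by (auto simp: u_def p_def nth_append)
  have bs: "u i \<in> B" if "i \<in> {p..<n}" for i
    using that ab by (auto simp: u_def p_def n_def nth_append)
  have "\<not> E (u i) (u j)" if "i < p" "j < p" for i j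
    using indep[OF as as] that by blast
  moreover have "u i \<noteq> u j" if "i < p" "j \<in> {p..<n}" for i j
    using as[OF that(1)] bs[OF that(2)] disj by auto
  ultimately have "sat UNIV E u prem"
    unfolding prem by simp
  then obtain z where "sat UNIV E (u(n := z)) conc"
    using E[of u] by auto
  then have zA: "\<forall>i<p. E z (u i)" and zB: "\<forall>j\<in>{p..<n}. \<not> E z (u j) \<and> z \<noteq> u j"
    unfolding conc by auto
  have A: "E z x" if "x \<in> A" for x
  proof -
    obtain i where "i < length as" "x = as ! i"
      using \<open>x \<in> A\<close> ab by (metis in_set_conv_nth)
    then show ?thesis using zA by (simp add: u_def p_def nth_append_left)
  qed
  have B: "\<not> E z x \<and> z \<noteq> x" if "x \<in> B" for x
  proof -
    obtain j where j: "j < length bs" "x = bs ! j"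
      using \<open>x \<in> B\<close> ab by (metis in_set_conv_nth)
    have "\<not> E z (u (p + j)) \<and> z \<noteq> u (p + j)"
      using zB j(1) by (simp add: p_def n_def)
    then show ?thesis using j by (simp add: u_def p_def)
  qed
  \<comment> \<open>\<open>conc\<close> keeps \<open>z\<close> out of \<open>B\<close> only. It is
    outside \<open>A\<close> because it is adjacent to all of \<open>A\<close> but not to
    itself.\<close>
  have "\<not> E z z"
    using valid_transfer[OF T, of "Neg (Adj 0 0)" "\<lambda>_. z"] H.irreflexive by auto
  then show "\<exists>z\<in>UNIV. z \<notin> A \<union> B \<and> (\<forall>x\<in>A. E z x) \<and> (\<forall>x\<in>B. \<not> E z x)"
    using A B by blast
qed

section \<open>The extension property of the Fraisse limit\<close>

lemma henson_graph_generic: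
  assumes "henson_graph UNIV H"
  shows "generic_triangle_free UNIV H"
proof
  have age: "in_age UNIV H V S \<longleftrightarrow> finite_triangle_free_graph V S" for V S
    using assms by (simp add: henson_graph_def fraisse_limit_def)
  have hom: "ultrahomogeneous UNIV H"
    using assms by (simp add: henson_graph_def fraisse_limit_def)
  \<comment> \<open>Ages consist of structures on natural numbers, so a finite part of
    \<open>H\<close> is pulled back along an enumeration \<open>g\<close>, which is then an
    embedding.\<close>
  have ftf: "finite_triangle_free_graph {..<n} (\<lambda>i j. H (g i) (g j))"
    if "inj_on g {..<n}" for n :: nat and g
  proof -
    have "embedding g {..<n} (\<lambda>i j. H (g i) (g j)) UNIV H"
      using that by (simp add: embedding_def)
    then show ?thesis
      unfolding age[symmetric] in_age_def by blast
  qed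
  have enum: "\<exists>g (n :: nat). inj_on g {..<n} \<and> g ` {..<n} = X" if "finite X" for X :: "'a set"
    using that ex_bij_betw_nat_finite[of X] by (auto simp: bij_betw_def atLeast0LessThan)
  have ftf': "finite_triangle_free_graph X H" if "finite X" for X
  proof -
    obtain g and n :: nat where g: "inj_on g {..<n}" "g ` {..<n} = X" using enum[OF \<open>finite X\<close>] by blast
    show ?thesis
      using ftf[OF g(1)]
      unfolding finite_triangle_free_graph_def g(2)[symmetric] ball_simps bex_simps by blast
  qed
  show irr: "\<not> H x x" for x
    using ftf'[of "{x}"] unfolding finite_triangle_free_graph_def by blast
  show sym: "H y x" if "H x y" for x y
    using ftf'[of "{x, y}"] that unfolding finite_triangle_free_graph_def by blast
  show tri: "\<not> H x z" if "H x y" "H y z" for x y z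
    using ftf'[of "{x, y, z}"] that unfolding finite_triangle_free_graph_def by blast
  fix A B :: "'a set"
  assume fin: "finite A" "finite B" and disj: "A \<inter> B = {}"
    and indep: "\<And>x y. x \<in> A \<Longrightarrow> y \<in> A \<Longrightarrow> \<not> H x y"
  obtain g and n :: nat where g: "inj_on g {..<n}" "g ` {..<n} = A \<union> B" using enum fin by blast
  \<comment> \<open>\<open>S\<close> is the graph on \<open>A \<union> B\<close>, indexed by
    \<open>g\<close>, with a new vertex \<open>n\<close> joined exactly to \<open>A\<close>. It is
    triangle-free because \<open>A\<close> has no edges, so it embeds into \<open>H\<close>.\<close>
  define S where "S i j \<longleftrightarrow> (if i = n then j \<noteq> n \<and> g j \<in> A else if j = n then g i \<in> A else H (g i) (g j))"
    for i j
  have "finite_triangle_free_graph {..n} S"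
  proof -
    have "\<not> S x x" and "S x y \<Longrightarrow> S y x" for x y
      using irr sym by (auto simp: S_def)
    moreover have "\<not> (S x y \<and> S y z \<and> S x z)" for x y z
      using irr sym tri indep unfolding S_def by metis
    ultimately show ?thesis unfolding finite_triangle_free_graph_def by blast
  qed
  then obtain f where f: "embedding f {..n} S UNIV H"
    using age in_age_def by blast
  then have finj: "inj_on f {..n}" and fadj: "\<And>i j. i \<le> n \<Longrightarrow> j \<le> n \<Longrightarrow> S i j \<longleftrightarrow> H (f i) (f j)"
    by (auto simp: embedding_def)
  have finj': "inj_on f {..<n}" using finj by (rule inj_on_subset) auto
  \<comment> \<open>The embedding \<open>f\<close> places a copy of \<open>A \<union> B\<close>
    somewhere in \<open>H\<close>. Homogeneity extends the isomorphism \<open>h\<close> from it back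
    to \<open>A \<union> B\<close> to an automorphism \<open>k\<close>, which takes the new vertex
    \<open>f n\<close> to the required point.\<close>
  define h where "h = g \<circ> the_inv_into {..<n} f"
  have h: "h (f i) = g i" if "i < n" for i
    using that finj' by (simp add: h_def the_inv_into_f_f)
  have "isomorphism h (f ` {..<n}) H (A \<union> B) H"
  proof -
    have "bij_betw h (f ` {..<n}) (A \<union> B)"
      using g finj' h by (auto simp: bij_betw_def inj_on_def image_image)
    moreover have "H x y \<longleftrightarrow> H (h x) (h y)" if "x \<in> f ` {..<n}" "y \<in> f ` {..<n}" for x y
      using that h by (auto simp: S_def fadj[symmetric])
    ultimately show ?thesis by (simp add: isomorphism_def)
  qed
  then obtain k where k: "isomorphism k UNIV H UNIV H" "\<forall>a\<in>f ` {..<n}. k a = h a"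
    using hom unfolding ultrahomogeneous_def by (metis finite_imageI finite_lessThan subset_UNIV)
  have kf: "k (f i) = g i" if "i < n" for i
    using k(2) h that by simp
  define z where "z = k (f n)"
  have "z \<noteq> g i \<and> (H z (g i) \<longleftrightarrow> g i \<in> A)" if "i < n" for i
  proof -
    have "f n \<noteq> f i" using that inj_onD[OF finj, of n i] by auto
    then have "k (f n) \<noteq> k (f i)"
      using k(1) by (auto simp: isomorphism_def bij_betw_def inj_def)
    moreover have "H (k (f n)) (k (f i)) \<longleftrightarrow> S n i"
      using k(1) fadj[of n i] that by (simp add: isomorphism_def)
    ultimately show ?thesis using that by (simp add: z_def kf S_def)
  qed
  then have "z \<noteq> x \<and> (H z x \<longleftrightarrow> x \<in> A)" if "x \<in> A \<union> B" for x
    using that g(2) by (metis imageE lessThan_iff)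
  then show "\<exists>z\<in>UNIV. z \<notin> A \<union> B \<and> (\<forall>x\<in>A. H z x) \<and> (\<forall>x\<in>B. \<not> H z x)"
    using disj by (intro bexI[of _ z]) auto
qed

section \<open>Types prescribed by their atomic formulas\<close>

text \<open>This is an atomic diagram, and by quantifier elimination it fixes a complete type over
  \<open>C\<close>. \<open>I\<close> prescribes the equalities and \<open>J\<close> the edges to
  \<open>C\<close>; both take entries of \<open>b\<close>, not positions, so repeated entries
  receive equal prescriptions.\<close>

definition copy_over :: "('a \<Rightarrow> 'a \<Rightarrow> bool) \<Rightarrow> 'a list \<Rightarrow> ('a \<Rightarrow> 'a \<Rightarrow> bool) \<Rightarrow> ('a \<Rightarrow> 'a \<Rightarrow> bool) \<Rightarrow>
    'a set \<Rightarrow> 'a list \<Rightarrow> bool" where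
  "copy_over E b I J C a \<longleftrightarrow> length a = length b \<and>
     (\<forall>i<length b. \<forall>k<length b.
        (a ! i = a ! k \<longleftrightarrow> b ! i = b ! k) \<and> (E (a ! i) (a ! k) \<longleftrightarrow> E (b ! i) (b ! k))) \<and>
     (\<forall>i<length b. \<forall>x\<in>C. (a ! i = x \<longleftrightarrow> I (b ! i) x) \<and> (E (a ! i) x \<longleftrightarrow> J (b ! i) x))"

text \<open>A copy is required only over the finitely many parameters of the formula, so its
  existence does not depend on saturation. By \<open>mem_copy_type_iff\<close> the choice of
  \<open>a\<close> is immaterial.\<close>

definition copy_type :: "('a \<Rightarrow> 'a \<Rightarrow> bool) \<Rightarrow> 'a list \<Rightarrow> ('a \<Rightarrow> 'a \<Rightarrow> bool) \<Rightarrow> ('a \<Rightarrow> 'a \<Rightarrow> bool) \<Rightarrow>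
    'a set \<Rightarrow> 'a pfm set" where
  "copy_type E b I J A = {(\<phi>, c) \<in> formulas_over (length b) A.
     \<exists>a. copy_over E b I J (set c) a \<and> holds E a (\<phi>, c)}"

lemma copy_over_mono: "copy_over E b I J C a \<Longrightarrow> C' \<subseteq> C \<Longrightarrow> copy_over E b I J C' a"
  unfolding copy_over_def by blast

lemma copy_overD:
  assumes "copy_over E b I J C a"
  shows "length a = length b"
    and "i < length b \<Longrightarrow> k < length b \<Longrightarrow> a ! i = a ! k \<longleftrightarrow> b ! i = b ! k"
    and "i < length b \<Longrightarrow> k < length b \<Longrightarrow> E (a ! i) (a ! k) \<longleftrightarrow> E (b ! i) (b ! k)"
    and "i < length b \<Longrightarrow> x \<in> C \<Longrightarrow> a ! i = x \<longleftrightarrow> I (b ! i) x"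
    and "i < length b \<Longrightarrow> x \<in> C \<Longrightarrow> E (a ! i) x \<longleftrightarrow> J (b ! i) x"
  using assms unfolding copy_over_def by blast+

lemma copy_type_restrict:
  "A \<subseteq> A' \<Longrightarrow> copy_type E b I J A' \<inter> formulas_over (length b) A = copy_type E b I J A"
  by (auto simp: copy_type_def formulas_over_def)

lemma holds_Neg [simp]: "holds E a (Neg \<phi>, c) \<longleftrightarrow> \<not> holds E a (\<phi>, c)"
  by (simp add: holds_def)

lemma equiv_overD:
  assumes "equiv_over E M c c'"
  shows "length c = length c'"
    and "i < length c \<Longrightarrow> j < length c \<Longrightarrow> c ! i = c ! j \<longleftrightarrow> c' ! i = c' ! j"
    and "i < length c \<Longrightarrow> j < length c \<Longrightarrow> E (c ! i) (c ! j) \<longleftrightarrow> E (c' ! i) (c' ! j)"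
    and "i < length c \<Longrightarrow> m \<in> M \<Longrightarrow> c ! i = m \<longleftrightarrow> c' ! i = m"
    and "i < length c \<Longrightarrow> m \<in> M \<Longrightarrow> E (c ! i) m \<longleftrightarrow> E (c' ! i) m"
proof -
  show len: "length c = length c'" using assms by (simp add: equiv_over_def)
  have h: "holds E c (\<phi>, d) \<longleftrightarrow> holds E c' (\<phi>, d)"
    if "set d \<subseteq> M" "fv \<phi> \<subseteq> {..<length c + length d}" for \<phi> d
  proof -
    have "(\<phi>, d) \<in> tp E c M \<longleftrightarrow> (\<phi>, d) \<in> tp E c' M"
      using assms by (simp add: equiv_over_def)
    then show ?thesis using that len by (simp add: tp_def formulas_over_def)
  qed
  show "i < length c \<Longrightarrow> j < length c \<Longrightarrow> c ! i = c ! j \<longleftrightarrow> c' ! i = c' ! j"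
    using h[of "[]" "Eq i j"] by (simp add: holds_def)
  show "i < length c \<Longrightarrow> j < length c \<Longrightarrow> E (c ! i) (c ! j) \<longleftrightarrow> E (c' ! i) (c' ! j)"
    using h[of "[]" "Adj i j"] by (simp add: holds_def)
  show "i < length c \<Longrightarrow> m \<in> M \<Longrightarrow> c ! i = m \<longleftrightarrow> c' ! i = m"
    using h[of "[m]" "Eq i (length c)"] len by (simp add: holds_def nth_append)
  show "i < length c \<Longrightarrow> m \<in> M \<Longrightarrow> E (c ! i) m \<longleftrightarrow> E (c' ! i) m"
    using h[of "[m]" "Adj i (length c)"] len by (simp add: holds_def nth_append)
qed

lemma equiv_over_refl: "equiv_over E M c c"
  by (simp add: equiv_over_def)

lemma equiv_over_of_tp_subset:
  assumes "length a = length b" and "\<And>\<theta>. \<theta> \<in> tp E b M \<Longrightarrow> holds E a \<theta>"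
  shows "equiv_over E M a b"
proof -
  have "holds E a (\<phi>, d) \<longleftrightarrow> holds E b (\<phi>, d)" if "(\<phi>, d) \<in> formulas_over (length b) M" for \<phi> d
  proof -
    have "(Neg \<phi>, d) \<in> formulas_over (length b) M"
      using that by (simp add: formulas_over_def)
    then show ?thesis
      using that assms(2)[of "(\<phi>, d)"] assms(2)[of "(Neg \<phi>, d)"] by (auto simp: tp_def)
  qed
  then show ?thesis
    using assms(1) by (auto simp: equiv_over_def tp_def)
qed

locale generic_universe = generic_triangle_free UNIV E for E :: "'a \<Rightarrow> 'a \<Rightarrow> bool"
begin

lemma adj_commute: "E x y \<longleftrightarrow> E y x"
  using symmetric[of x y] symmetric[of y x] by auto

lemma no_triangle: "E x y \<Longrightarrow> E y z \<Longrightarrow> E x z \<Longrightarrow> False"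
  using triangle_free[of x y z] by simp

text \<open>The tuples \<open>a @ c\<close> and \<open>a' @ c'\<close> have the same atoms: within
  \<open>a\<close> and \<open>a'\<close> both follow \<open>b\<close>, within \<open>c\<close> and
  \<open>c'\<close> the types over \<open>M\<close> agree, and the mixed atoms are given by
  \<open>I\<close> and \<open>J\<close>. With \<open>c = c'\<close> this yields uniqueness, in
  general invariance.\<close>

lemma holds_copy_iff:
  assumes a: "copy_over E b I J (set c) a" "copy_over E b I J (set c') a'"
    and c: "equiv_over E M c c'"
    and inv: "\<And>i j. i < length b \<Longrightarrow> j < length c \<Longrightarrow>
      (I (b ! i) (c ! j) \<longleftrightarrow> I (b ! i) (c' ! j)) \<and> (J (b ! i) (c ! j) \<longleftrightarrow> J (b ! i) (c' ! j))"
    and \<phi>: "fv \<phi> \<subseteq> {..<length b + length c}"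
  shows "holds E a (\<phi>, c) \<longleftrightarrow> holds E a' (\<phi>, c')"
proof -
  let ?n = "length b"
  note D = copy_overD[OF a(1)] and D' = copy_overD[OF a(2)] and C = equiv_overD[OF c]
  have mixed: "(a ! i = c ! j \<longleftrightarrow> a' ! i = c' ! j) \<and> (E (a ! i) (c ! j) \<longleftrightarrow> E (a' ! i) (c' ! j))"
    if "i < ?n" "j < length c" for i j
    using that D(4,5)[of i "c ! j"] D'(4,5)[of i "c' ! j"] inv[OF that] C(1) by simp
  have "((a @ c) ! i = (a @ c) ! j \<longleftrightarrow> (a' @ c') ! i = (a' @ c') ! j) \<and>
      (E ((a @ c) ! i) ((a @ c) ! j) \<longleftrightarrow> E ((a' @ c') ! i) ((a' @ c') ! j))"
    if ij: "i < ?n + length c" "j < ?n + length c" for i j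
  proof -
    consider "i < ?n" "j < ?n" | j' where "i < ?n" "j = ?n + j'" "j' < length c"
      | i' where "i = ?n + i'" "i' < length c" "j < ?n"
      | i' j' where "i = ?n + i'" "i' < length c" "j = ?n + j'" "j' < length c"
      using ij by (metis add_less_cancel_left le_add_diff_inverse not_less)
    then show ?thesis
    proof cases
      case 1
      then show ?thesis using D(1-3) D'(1-3) by (simp add: nth_append)
    next
      case 2
      then show ?thesis using D(1) D'(1) mixed by (simp add: nth_append)
    next
      case (3 i')
      then show ?thesis using D(1) D'(1) mixed[of j i']
        by (simp add: nth_append adj_commute[of "c ! i'"] adj_commute[of "c' ! i'"]
            eq_commute[of "c ! i'"] eq_commute[of "c' ! i'"])
    next
      case 4
      then show ?thesis using D(1) D'(1) C(2,3) by (simp add: nth_append)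
    qed
  qed
  then have "same_atoms E E {..<?n + length c} (\<lambda>i. (a @ c) ! i) (\<lambda>i. (a' @ c') ! i)"
    unfolding same_atoms_def by blast
  then have "sat UNIV E (\<lambda>i. (a @ c) ! i) \<phi> \<longleftrightarrow> sat UNIV E (\<lambda>i. (a' @ c') ! i) \<phi>"
    by (intro sat_iff_of_same_atoms generic_triangle_free_axioms subset_UNIV same_atoms_mono[OF _ \<phi>])
  then show ?thesis by (simp add: holds_def)
qed

lemma mem_copy_type_iff:
  assumes "copy_over E b I J (set c) a" "(\<phi>, c) \<in> formulas_over (length b) A"
  shows "(\<phi>, c) \<in> copy_type E b I J A \<longleftrightarrow> holds E a (\<phi>, c)"
proof -
  have "holds E a' (\<phi>, c) \<longleftrightarrow> holds E a (\<phi>, c)" if "copy_over E b I J (set c) a'" for a'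
    using holds_copy_iff[OF that assms(1) equiv_over_refl] assms(2) by (simp add: formulas_over_def)
  then show ?thesis
    using assms unfolding copy_type_def by blast
qed

text \<open>Finitely many formulas have finitely many parameters, and one copy over these satisfies
  all of them.\<close>

lemma complete_copy_type:
  assumes ex: "\<And>C. finite C \<Longrightarrow> C \<subseteq> A \<Longrightarrow> \<exists>a. copy_over E b I J C a"
  shows "complete_type E (length b) A (copy_type E b I J A)"
  unfolding complete_type_def
proof (intro conjI)
  show "copy_type E b I J A \<subseteq> formulas_over (length b) A"
    by (auto simp: copy_type_def)
  show "consistent E (length b) (copy_type E b I J A)"
    unfolding consistent_def
  proof (intro allI impI)
    fix F assume F: "finite F \<and> F \<subseteq> copy_type E b I J A"
    have "F \<subseteq> formulas_over (length b) A"
      using F by (auto simp: copy_type_def)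
    then have "finite (\<Union>\<theta>\<in>F. set (snd \<theta>))" "(\<Union>\<theta>\<in>F. set (snd \<theta>)) \<subseteq> A"
      using F by (fastforce simp: formulas_over_def)+
    then obtain a where a: "copy_over E b I J (\<Union>\<theta>\<in>F. set (snd \<theta>)) a"
      using ex by blast
    have "holds E a \<theta>" if "\<theta> \<in> F" for \<theta>
    proof -
      obtain \<phi> c where \<theta>: "\<theta> = (\<phi>, c)" by (cases \<theta>)
      have "copy_over E b I J (set c) a"
        using that \<theta> by (intro copy_over_mono[OF a]) force
      then show ?thesis
        using mem_copy_type_iff[of b I J c a \<phi> A] F that \<theta> by (auto simp: copy_type_def)
    qed
    then show "\<exists>a. length a = length b \<and> (\<forall>\<theta>\<in>F. holds E a \<theta>)"
      using copy_overD(1)[OF a] by blast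
  qed
  show "\<forall>(\<phi>, c)\<in>formulas_over (length b) A.
      (\<phi>, c) \<in> copy_type E b I J A \<or> (Neg \<phi>, c) \<in> copy_type E b I J A"
  proof clarify
    fix \<phi> c assume c: "(\<phi>, c) \<in> formulas_over (length b) A"
      and "(Neg \<phi>, c) \<notin> copy_type E b I J A"
    moreover have "(Neg \<phi>, c) \<in> formulas_over (length b) A"
      using c by (simp add: formulas_over_def)
    moreover obtain a where "copy_over E b I J (set c) a"
      using ex[of "set c"] c by (auto simp: formulas_over_def)
    ultimately show "(\<phi>, c) \<in> copy_type E b I J A"
      using mem_copy_type_iff[of b I J c a] by auto
  qed
qed

text \<open>The type decides every atomic formula, and comparison with a copy over at most one
  parameter shows which way.\<close>

lemma copy_over_of_realizes:
  assumes ex: "\<And>C. finite C \<Longrightarrow> C \<subseteq> A \<Longrightarrow> \<exists>a. copy_over E b I J C a"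
    and a: "length a = length b" "\<And>\<theta>. \<theta> \<in> copy_type E b I J A \<Longrightarrow> holds E a \<theta>"
  shows "copy_over E b I J A a"
proof -
  have h: "holds E a (\<phi>, c) \<longleftrightarrow> holds E a' (\<phi>, c)"
    if "(\<phi>, c) \<in> formulas_over (length b) A" "copy_over E b I J (set c) a'" for \<phi> c a'
  proof -
    have "(Neg \<phi>, c) \<in> formulas_over (length b) A"
      using that by (simp add: formulas_over_def)
    then show ?thesis
      using that mem_copy_type_iff[OF that(2)] a(2)[of "(\<phi>, c)"] a(2)[of "(Neg \<phi>, c)"] by auto
  qed
  show ?thesis
    unfolding copy_over_def
  proof (intro conjI allI impI ballI a(1))
    fix i k assume ik: "i < length b" "k < length b"
    obtain a' where a': "copy_over E b I J (set []) a'" using ex[of "{}"] by auto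
    show "a ! i = a ! k \<longleftrightarrow> b ! i = b ! k"
      using h[of "Eq i k", OF _ a'] copy_overD[OF a'] ik a(1)
      by (simp add: holds_def formulas_over_def)
    show "E (a ! i) (a ! k) \<longleftrightarrow> E (b ! i) (b ! k)"
      using h[of "Adj i k", OF _ a'] copy_overD[OF a'] ik a(1)
      by (simp add: holds_def formulas_over_def)
  next
    fix i x assume i: "i < length b" and x: "x \<in> A"
    obtain a' where a': "copy_over E b I J (set [x]) a'" using ex[of "{x}"] x by auto
    show "a ! i = x \<longleftrightarrow> I (b ! i) x"
      using h[of "Eq i (length b)", OF _ a'] copy_overD[OF a'] i x a(1)
      by (simp add: holds_def formulas_over_def nth_append)
    show "E (a ! i) x \<longleftrightarrow> J (b ! i) x"
      using h[of "Adj i (length b)", OF _ a'] copy_overD[OF a'] i x a(1)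
      by (simp add: holds_def formulas_over_def nth_append)
  qed
qed

text \<open>The entries of \<open>b\<close> are copied one at a time by \<open>extension\<close>,
  those in \<open>M\<close> staying fixed. Possible triangles are excluded by \<open>J_indep\<close>
  if they contain one copy, by \<open>J_adj\<close> if they contain two, and by the absence of
  triangles among the originals if they contain three.\<close>

lemma copy_exists:
  assumes "finite C"
    and J_M: "\<And>d x. d \<in> set b \<Longrightarrow> d \<in> M \<or> x \<in> M \<inter> set b \<Longrightarrow> J d x \<longleftrightarrow> E d x"
    and J_indep: "\<And>d x y. d \<in> set b \<Longrightarrow> d \<notin> M \<Longrightarrow> J d x \<Longrightarrow> J d y \<Longrightarrow> \<not> E x y"
    and J_adj: "\<And>d e x. d \<in> set b \<Longrightarrow> d \<notin> M \<Longrightarrow> e \<in> set b \<Longrightarrow> E d e \<Longrightarrow> J d x \<Longrightarrow> \<not> J e x"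
  shows "\<exists>a. copy_over E b (\<lambda>d x. d = x \<and> d \<in> M) J C a"
proof -
  \<comment> \<open>With the entries of \<open>b\<close> in \<open>M\<close> among the parameters,
    these entries are their own copies, and \<open>J\<close>, which agrees with \<open>E\<close>
    there, settles all edges to them.\<close>
  define C' where "C' = C \<union> (M \<inter> set b)"
  have "finite C'" using assms(1) by (simp add: C'_def)
  have "\<exists>f. (\<forall>d\<in>D. \<forall>e\<in>D. (f d = f e \<longleftrightarrow> d = e) \<and> (E (f d) (f e) \<longleftrightarrow> E d e)) \<and>
      (\<forall>d\<in>D. \<forall>x\<in>C'. (f d = x \<longleftrightarrow> d = x \<and> d \<in> M) \<and> (E (f d) x \<longleftrightarrow> J d x))"
    if "finite D" "D \<subseteq> set b" for D
    using that
  proof (induction D)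
    case (insert d D)
    then obtain f where
      "\<forall>d\<in>D. \<forall>e\<in>D. (f d = f e \<longleftrightarrow> d = e) \<and> (E (f d) (f e) \<longleftrightarrow> E d e)"
      "\<forall>d\<in>D. \<forall>x\<in>C'. (f d = x \<longleftrightarrow> d = x \<and> d \<in> M) \<and> (E (f d) x \<longleftrightarrow> J d x)"
      by auto
    then have f: "\<And>x y. x \<in> D \<Longrightarrow> y \<in> D \<Longrightarrow> f x = f y \<longleftrightarrow> x = y"
        "\<And>x y. x \<in> D \<Longrightarrow> y \<in> D \<Longrightarrow> E (f x) (f y) \<longleftrightarrow> E x y"
        "\<And>x y. x \<in> D \<Longrightarrow> y \<in> C' \<Longrightarrow> f x = y \<longleftrightarrow> x = y \<and> x \<in> M"
        "\<And>x y. x \<in> D \<Longrightarrow> y \<in> C' \<Longrightarrow> E (f x) y \<longleftrightarrow> J x y"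
      by blast+
    have sub: "d \<in> set b" "\<And>e. e \<in> D \<Longrightarrow> e \<in> set b" using insert.prems by auto
    have extend: "\<exists>f. (\<forall>x\<in>insert d D. \<forall>y\<in>insert d D.
          (f x = f y \<longleftrightarrow> x = y) \<and> (E (f x) (f y) \<longleftrightarrow> E x y)) \<and>
        (\<forall>x\<in>insert d D. \<forall>y\<in>C'. (f x = y \<longleftrightarrow> x = y \<and> x \<in> M) \<and> (E (f x) y \<longleftrightarrow> J x y))"
      if z: "\<And>e. e \<in> D \<Longrightarrow> z \<noteq> f e \<and> (E z (f e) \<longleftrightarrow> E d e)"
        "\<And>x. x \<in> C' \<Longrightarrow> (z = x \<longleftrightarrow> d = x \<and> d \<in> M) \<and> (E z x \<longleftrightarrow> J d x)" for z
    proof -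
      have "E (f e) z \<longleftrightarrow> E e d" if "e \<in> D" for e
        using z(1)[OF that] adj_commute by blast
      moreover have "e \<noteq> d" if "e \<in> D" for e
        using that insert.hyps by blast
      moreover have "\<not> E z z" "\<not> E d d" using irreflexive by auto
      ultimately show ?thesis
        using f z by (intro exI[of _ "f(d := z)"]) (simp add: eq_commute)
    qed
    show ?case
    proof (cases "d \<in> M")
      case True
      have "d \<in> C'" using True sub by (simp add: C'_def)
      show ?thesis
      proof (rule extend[of d])
        fix e assume e: "e \<in> D"
        have "E (f e) d \<longleftrightarrow> E e d"
          using f(4)[OF e \<open>d \<in> C'\<close>] J_M[of e d] sub e True by simp
        moreover have "f e \<noteq> d"
          using f(3)[OF e \<open>d \<in> C'\<close>] e insert.hyps by auto
        ultimately show "d \<noteq> f e \<and> (E d (f e) \<longleftrightarrow> E d e)"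
          using adj_commute by blast
      next
        fix x
        show "(d = x \<longleftrightarrow> d = x \<and> d \<in> M) \<and> (E d x \<longleftrightarrow> J d x)"
          using True J_M sub by auto
      qed
    next
      case False
      \<comment> \<open>\<open>X\<close> collects the intended neighbours of the copy of
        \<open>d\<close>. The prescriptions agree where \<open>C'\<close> meets the earlier copies:
        by \<open>D_C\<close> such copies are entries in \<open>M\<close>.\<close>
      define X where "X = {x \<in> C'. J d x} \<union> f ` {e \<in> D. E d e}"
      have D_C: "f e = e \<and> e \<in> M \<and> (J d (f e) \<longleftrightarrow> E d e)" if "e \<in> D" "f e \<in> C'" for e
      proof -
        have *: "f e = e" "e \<in> M" using f(3)[OF that] by metis+
        then show ?thesis using J_M[of d e] sub that(1) by simp
      qed
      have X_C: "x \<in> X \<longleftrightarrow> J d x" if "x \<in> C'" for x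
        using that D_C unfolding X_def by auto
      have X_D: "f e \<in> X \<longleftrightarrow> E d e" if "e \<in> D" for e
        using that D_C[OF that] f(1) unfolding X_def by auto
      have "\<exists>z\<in>UNIV. z \<notin> X \<union> (C' \<union> f ` D - X) \<and> (\<forall>x\<in>X. E z x) \<and>
          (\<forall>x\<in>C' \<union> f ` D - X. \<not> E z x)"
      proof (rule extension)
        show "finite X" "finite (C' \<union> f ` D - X)"
          using \<open>finite C'\<close> insert.hyps by (auto simp: X_def)
        have CD: "\<not> E x (f e)" if "x \<in> C'" "J d x" "e \<in> D" "E d e" for x e
          using that J_adj[of d e x] f(4)[of e x] sub False adj_commute[of x] by auto
        show "\<not> E x y" if "x \<in> X" "y \<in> X" for x y
        proof -
          consider "J d x" "J d y" | e where "x \<in> C'" "J d x" "e \<in> D" "E d e" "y = f e"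
            | e where "y \<in> C'" "J d y" "e \<in> D" "E d e" "x = f e"
            | e e' where "e \<in> D" "E d e" "x = f e" "e' \<in> D" "E d e'" "y = f e'"
            using \<open>x \<in> X\<close> \<open>y \<in> X\<close> unfolding X_def by auto
          then show ?thesis
          proof cases
            case 1
            then show ?thesis using J_indep sub False by blast
          next
            case 2
            then show ?thesis using CD by blast
          next
            case 3
            then show ?thesis using CD adj_commute by blast
          next
            case 4
            then show ?thesis using f(2) no_triangle by blast
          qed
        qed
      qed auto
      then obtain z where z: "z \<notin> C' \<union> f ` D" "\<And>x. x \<in> C' \<union> f ` D \<Longrightarrow> E z x \<longleftrightarrow> x \<in> X"
        by blast
      show ?thesis
      proof (rule extend[of z])
        show "z \<noteq> f e \<and> (E z (f e) \<longleftrightarrow> E d e)" if "e \<in> D" for e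
          using z X_D that by auto
        show "(z = x \<longleftrightarrow> d = x \<and> d \<in> M) \<and> (E z x \<longleftrightarrow> J d x)" if "x \<in> C'" for x
          using z X_C that False by auto
      qed
    qed
  qed simp
  from this[of "set b"] obtain f where f:
    "\<forall>d\<in>set b. \<forall>e\<in>set b. (f d = f e \<longleftrightarrow> d = e) \<and> (E (f d) (f e) \<longleftrightarrow> E d e)"
    "\<forall>d\<in>set b. \<forall>x\<in>C'. (f d = x \<longleftrightarrow> d = x \<and> d \<in> M) \<and> (E (f d) x \<longleftrightarrow> J d x)"
    by auto
  have "copy_over E b (\<lambda>d x. d = x \<and> d \<in> M) J C (map f b)"
    using f unfolding copy_over_def by (auto simp: C'_def)
  then show ?thesis by blast
qed

end

section \<open>Invariant types do not fork\<close>

lemma morley_sequence_equiv: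
  assumes "tp E b M \<subseteq> q" "morley_sequence E M (length b) q s"
  shows "equiv_over E M (s i) b"
proof (rule equiv_over_of_tp_subset)
  have s: "realizes_restriction E (length b) q (M \<union> (\<Union>j<i. set (s j))) (s i)"
    using assms(2) by (simp add: morley_sequence_def)
  then show "length (s i) = length b"
    by (simp add: realizes_restriction_def)
  fix \<theta> assume "\<theta> \<in> tp E b M"
  then have "\<theta> \<in> q \<inter> formulas_over (length b) (M \<union> (\<Union>j<i. set (s j)))"
    using assms(1) by (auto simp: tp_def formulas_over_def)
  then show "holds E (s i) \<theta>"
    using s by (simp add: realizes_restriction_def)
qed

text \<open>By invariance all instances along \<open>s\<close> lie in the consistent type
  \<open>r\<close>. Only the type of the single terms of \<open>s\<close> over \<open>M\<close>
  matters, so dividing and Kim-dividing are excluded alike.\<close>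

lemma invariant_type_not_divides_along:
  assumes r: "global_invariant_type E M n r" and "(\<phi>, b) \<in> r"
    and s: "\<And>i. equiv_over E M (s i) b"
  shows "\<not> divides_along E n \<phi> s"
proof -
  have "(\<phi>, b) \<in> formulas_over n UNIV"
    using r assms(2) by (auto simp: global_invariant_type_def complete_type_def)
  then have "fv \<phi> \<subseteq> {..<n + length (s i)}" for i
    using equiv_overD(1)[OF s] by (simp add: formulas_over_def)
  then have "(\<phi>, s i) \<in> r" for i
    using r assms(2) s[of i] unfolding global_invariant_type_def by blast
  then have "range (\<lambda>i. (\<phi>, s i)) \<subseteq> r" by blast
  moreover have "consistent E n r"
    using r by (simp add: global_invariant_type_def complete_type_def)
  ultimately show ?thesis
    unfolding divides_along_def consistent_def by (meson subset_trans)
qed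

text \<open>This takes the step from dividing to forking: if no disjunct were in \<open>r\<close>,
  the negations together with \<open>\<theta>\<close> would form a finite inconsistent part of
  \<open>r\<close>.\<close>

lemma complete_type_disj:
  assumes r: "complete_type E n UNIV r" and "\<theta> \<in> r"
    and \<Psi>: "finite \<Psi>" "\<Psi> \<subseteq> formulas_over n UNIV" "implies_disj E n \<theta> \<Psi>"
  shows "\<exists>\<psi>\<in>\<Psi>. \<psi> \<in> r"
proof (rule ccontr)
  assume none: "\<not> (\<exists>\<psi>\<in>\<Psi>. \<psi> \<in> r)"
  define F where "F = insert \<theta> ((\<lambda>(\<phi>, c). (Neg \<phi>, c)) ` \<Psi>)"
  have "(Neg \<phi>, c) \<in> r" if "(\<phi>, c) \<in> \<Psi>" for \<phi> c
    using that none r \<Psi>(2) unfolding complete_type_def by blast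
  then have "finite F" "F \<subseteq> r"
    using assms(2) \<Psi>(1) by (auto simp: F_def)
  then obtain a where a: "length a = n" "\<forall>\<theta>\<in>F. holds E a \<theta>"
    using r unfolding complete_type_def consistent_def by blast
  then obtain \<psi> where "\<psi> \<in> \<Psi>" "holds E a \<psi>"
    using \<Psi>(3) unfolding implies_disj_def F_def by blast
  moreover obtain \<phi> c where "\<psi> = (\<phi>, c)" by (cases \<psi>)
  ultimately have "(Neg \<phi>, c) \<in> F" "holds E a (\<phi>, c)"
    by (force simp: F_def)+
  then show False using a(2) holds_Neg by blast
qed

lemma invariant_type_not_forks:
  assumes r: "global_invariant_type E M n r" and "\<theta> \<in> r"
  shows "\<not> forks E M n \<theta>" and "\<not> kim_forks E M n \<theta>"
proof -
  have c: "complete_type E n UNIV r" using r by (simp add: global_invariant_type_def)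
  have "\<not> divides E M n \<psi>" if "\<psi> \<in> r" for \<psi>
    using invariant_type_not_divides_along[OF r] that by (cases \<psi>) (auto simp: divides_def)
  then show "\<not> forks E M n \<theta>"
    using complete_type_disj[OF c assms(2)] unfolding forks_def by blast
  have "\<not> kim_divides E M n \<psi>" if "\<psi> \<in> r" for \<psi>
  proof (cases \<psi>)
    case (Pair \<phi> b)
    show ?thesis
    proof
      assume "kim_divides E M n \<psi>"
      then obtain q s where s: "tp E b M \<subseteq> q" "morley_sequence E M (length b) q s"
          "divides_along E n \<phi> s"
        by (auto simp: kim_divides_def Pair)
      have "\<not> divides_along E n \<phi> s"
        using that Pair morley_sequence_equiv[OF s(1,2)]
        by (intro invariant_type_not_divides_along[OF r]) auto
      with s(3) show False by blast
    qed
  qed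
  then show "\<not> kim_forks E M n \<theta>"
    using complete_type_disj[OF c assms(2)] unfolding kim_forks_def by blast
qed

section \<open>Strict invariant types\<close>

text \<open>In the graphs at hand this is equality of types over \<open>M\<close> for single
  elements, by quantifier elimination.\<close>

definition same_over :: "('a \<Rightarrow> 'a \<Rightarrow> bool) \<Rightarrow> 'a set \<Rightarrow> 'a \<Rightarrow> 'a \<Rightarrow> bool" where
  "same_over E M x y \<longleftrightarrow> (\<forall>m\<in>M. (x = m \<longleftrightarrow> y = m) \<and> (E x m \<longleftrightarrow> E y m))"

text \<open>The assumptions make it possible to join new copies of the elements of \<open>P\<close> to all elements
  of \<open>Q\<close> without creating a triangle. They are symmetric in \<open>P\<close> and \<open>Q\<close>, which is why the
  resulting invariant types are strict.\<close>

locale linked_sets = generic_universe E for E :: "'a \<Rightarrow> 'a \<Rightarrow> bool" +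
  fixes M P Q :: "'a set"
  assumes P_indep: "x \<in> P \<Longrightarrow> y \<in> P \<Longrightarrow> \<not> E x y"
    and Q_indep: "x \<in> Q \<Longrightarrow> y \<in> Q \<Longrightarrow> \<not> E x y"
    and no_common_neighbour: "m \<in> M \<Longrightarrow> x \<in> P \<Longrightarrow> y \<in> Q \<Longrightarrow> E x m \<Longrightarrow> \<not> E y m"
    and P_invariant: "same_over E M x y \<Longrightarrow> x \<in> P \<longleftrightarrow> y \<in> P"
    and Q_invariant: "same_over E M x y \<Longrightarrow> x \<in> Q \<longleftrightarrow> y \<in> Q"
begin

text \<open>Edges involving \<open>M\<close> are forced by the type over \<open>M\<close>. The only
  others join copies of elements of \<open>P\<close> to all of \<open>Q\<close> outside
  \<open>M\<close>; with \<open>P\<close> empty this is the free extension.\<close>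

definition link :: "'a \<Rightarrow> 'a \<Rightarrow> bool" where
  "link d x \<longleftrightarrow> (if d \<in> M \<or> x \<in> M then E d x else d \<in> P \<and> x \<in> Q)"

abbreviation link_copy :: "'a list \<Rightarrow> 'a set \<Rightarrow> 'a list \<Rightarrow> bool" where
  "link_copy b \<equiv> copy_over E b (\<lambda>d x. d = x \<and> d \<in> M) link"

abbreviation link_type :: "'a list \<Rightarrow> 'a set \<Rightarrow> 'a pfm set" where
  "link_type b \<equiv> copy_type E b (\<lambda>d x. d = x \<and> d \<in> M) link"

lemma swap: "linked_sets E M Q P"
proof
  show "\<not> E y m" if "m \<in> M" "x \<in> Q" "y \<in> P" "E x m" for m x y
    using no_common_neighbour[of m y x] that by blast
qed (use Q_indep P_indep Q_invariant P_invariant in simp_all)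

text \<open>In a triangle at the copy of \<open>d\<close>, the other two vertices could both be in
  \<open>M\<close>, but \<open>E\<close> has no triangles; or one in \<open>M\<close> and one in
  \<open>Q\<close>, contrary to \<open>no_common_neighbour\<close>; or both in \<open>Q\<close>,
  which is independent. For two adjacent entries \<open>d\<close> and \<open>e\<close>,
  \<open>P_indep\<close> replaces \<open>Q_indep\<close>.\<close>

lemma link_copy_exists:
  assumes "finite C"
  shows "\<exists>a. link_copy b C a"
proof (rule copy_exists[OF assms])
  fix d x assume "d \<in> M \<or> x \<in> M \<inter> set b"
  then show "link d x \<longleftrightarrow> E d x" by (auto simp: link_def)
next
  fix d x y assume d: "d \<notin> M" and xy: "link d x" "link d y"
  show "\<not> E x y"
  proof (cases "x \<in> M"; cases "y \<in> M")
    assume "x \<in> M" "y \<in> M"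
    then show ?thesis using xy no_triangle[of d x y] by (auto simp: link_def)
  next
    assume "x \<in> M" "y \<notin> M"
    then show ?thesis
      using d xy no_common_neighbour[of x d y] adj_commute[of x y] by (auto simp: link_def)
  next
    assume "x \<notin> M" "y \<in> M"
    then show ?thesis
      using d xy no_common_neighbour[of y d x] by (auto simp: link_def)
  next
    assume "x \<notin> M" "y \<notin> M"
    then show ?thesis using d xy Q_indep[of x y] by (auto simp: link_def)
  qed
next
  fix d e x assume d: "d \<notin> M" and de: "E d e" and x: "link d x"
  show "\<not> link e x"
  proof (cases "x \<in> M")
    case True
    then show ?thesis using de x no_triangle[of d e x] by (auto simp: link_def)
  next
    case False
    then show ?thesis
      using d de x no_common_neighbour[of e d x] P_indep[of d e] adj_commute[of e x]
      by (auto simp: link_def)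
  qed
qed

lemma link_type_complete: "complete_type E (length b) A (link_type b A)"
  using link_copy_exists by (intro complete_copy_type)

lemma link_invariant:
  assumes *: "same_over E M x y"
  shows "(d = x \<and> d \<in> M \<longleftrightarrow> d = y \<and> d \<in> M) \<and> (link d x \<longleftrightarrow> link d y)"
proof -
  have eq: "x \<in> M \<or> y \<in> M \<Longrightarrow> x = y" using * unfolding same_over_def by metis
  have "d \<in> M \<Longrightarrow> E d x \<longleftrightarrow> E d y"
    using * adj_commute[of d] by (simp add: same_over_def)
  then have "link d x \<longleftrightarrow> link d y"
    using eq Q_invariant[OF *] unfolding link_def by metis
  then show ?thesis using eq by blast
qed

lemma same_over_nth: "equiv_over E M c c' \<Longrightarrow> j < length c \<Longrightarrow> same_over E M (c ! j) (c' ! j)"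
  by (simp add: same_over_def equiv_overD(4,5)[of E M c c'])

lemma link_type_invariant: "global_invariant_type E M (length b) (link_type b UNIV)"
  unfolding global_invariant_type_def
proof (intro conjI allI impI link_type_complete)
  fix \<phi> and c c' :: "'a list"
  assume *: "fv \<phi> \<subseteq> {..<length b + length c} \<and> equiv_over E M c c'"
  obtain a a' where a: "link_copy b (set c) a" "link_copy b (set c') a'"
    using link_copy_exists[OF finite_set] by blast
  have "holds E a (\<phi>, c) \<longleftrightarrow> holds E a' (\<phi>, c')"
  proof (rule holds_copy_iff[OF a])
    show "equiv_over E M c c'" "fv \<phi> \<subseteq> {..<length b + length c}" using * by auto
    show "(b ! i = c ! j \<and> b ! i \<in> M \<longleftrightarrow> b ! i = c' ! j \<and> b ! i \<in> M) \<and>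
        (link (b ! i) (c ! j) \<longleftrightarrow> link (b ! i) (c' ! j))" if "j < length c" for i j
      using * that by (intro link_invariant same_over_nth) auto
  qed
  moreover have "length c = length c'" using * equiv_overD(1) by blast
  ultimately show "(\<phi>, c) \<in> link_type b UNIV \<longleftrightarrow> (\<phi>, c') \<in> link_type b UNIV"
    using * mem_copy_type_iff[OF a(1), of \<phi> UNIV] mem_copy_type_iff[OF a(2), of \<phi> UNIV]
    by (simp add: formulas_over_def)
qed

text \<open>The hypotheses make \<open>b\<close> its own copy over \<open>A\<close>. Over
  \<open>M\<close> they always hold; with \<open>P\<close> and \<open>Q\<close> exchanged, they lead
  to strictness.\<close>

lemma tp_subset_link_type:
  assumes "\<And>d x. d \<in> set b \<Longrightarrow> x \<in> A \<Longrightarrow> (d = x \<longrightarrow> d \<in> M) \<and> (E d x \<longleftrightarrow> link d x)"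
  shows "tp E b A \<subseteq> link_type b UNIV"
proof
  fix \<theta> assume \<theta>: "\<theta> \<in> tp E b A"
  obtain \<phi> c where [simp]: "\<theta> = (\<phi>, c)" by (cases \<theta>)
  have c: "set c \<subseteq> A" "(\<phi>, c) \<in> formulas_over (length b) UNIV" "holds E b (\<phi>, c)"
    using \<theta> by (auto simp: tp_def formulas_over_def)
  have "(d = x \<longleftrightarrow> d = x \<and> d \<in> M) \<and> (E d x \<longleftrightarrow> link d x)" if "d \<in> set b" "x \<in> set c" for d x
    using assms[of d x] that c(1) by blast
  then have "link_copy b (set c) b"
    unfolding copy_over_def by simp
  then show "\<theta> \<in> link_type b UNIV"
    using mem_copy_type_iff c(2,3) by simp
qed

lemma tp_base_subset_link_type: "tp E b M \<subseteq> link_type b UNIV"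
  by (rule tp_subset_link_type) (auto simp: link_def)

lemma link_copy_of_realizes:
  assumes "realizes_restriction E (length b) (link_type b UNIV) A a"
  shows "link_copy b A a"
proof (rule copy_over_of_realizes)
  show "\<exists>a. link_copy b C a" if "finite C" for C by (rule link_copy_exists[OF that])
qed (use assms in \<open>simp_all add: realizes_restriction_def copy_type_restrict\<close>)

text \<open>The entries of \<open>a\<close> lie outside \<open>M \<union> B\<close>, and each looks
  over \<open>M\<close> like its original in \<open>b\<close>, so it is in \<open>P\<close> exactly
  when the original is. Read from the side of \<open>d\<close>, the edges prescribed by
  \<open>link\<close> are those of the link with \<open>P\<close> and \<open>Q\<close>
  exchanged.\<close>

lemma tp_subset_swapped:
  assumes b: "set b \<inter> M = {}" and a: "realizes_restriction E (length b) (link_type b UNIV) (M \<union> B) a"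
    and d: "set d \<subseteq> B"
  shows "tp E d (M \<union> set a) \<subseteq> copy_type E d (\<lambda>d x. d = x \<and> d \<in> M) (linked_sets.link E M Q P) UNIV"
proof -
  interpret swapped: linked_sets E M Q P by (rule swap)
  note A = copy_overD[OF link_copy_of_realizes[OF a]]
  show ?thesis
  proof (rule swapped.tp_subset_link_type)
    fix e x assume "e \<in> set d" "x \<in> M \<union> set a"
    then have e: "e \<in> B" using d by blast
    show "(e = x \<longrightarrow> e \<in> M) \<and> (E e x \<longleftrightarrow> swapped.link e x)"
    proof (cases "x \<in> M")
      case False
      then obtain i where i: "i < length b" "x = a ! i"
        using \<open>x \<in> M \<union> set a\<close> A(1) by (auto simp: in_set_conv_nth)
      have bi: "b ! i \<notin> M" using b i by (meson disjoint_iff nth_mem)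
      have "x \<noteq> e" using A(4)[of i e] i e bi by auto
      moreover have "E e x \<longleftrightarrow> swapped.link e x"
      proof (cases "e \<in> M")
        case False
        have "same_over E M x (b ! i)"
          using A(4,5)[of i] i bi by (auto simp: same_over_def link_def)
        then have "x \<in> P \<longleftrightarrow> b ! i \<in> P" by (rule P_invariant)
        moreover have "E x e \<longleftrightarrow> link (b ! i) e" using A(5)[of i e] i e by simp
        ultimately show ?thesis
          using False \<open>x \<notin> M\<close> bi adj_commute[of e x] by (auto simp: link_def swapped.link_def)
      qed (simp add: swapped.link_def)
      ultimately show ?thesis by blast
    qed (auto simp: swapped.link_def)
  qed
qed

lemma link_type_strict:
  assumes "set b \<inter> M = {}"
  shows "strict_invariant E M (length b) (link_type b UNIV)"
    and "kim_strict_invariant E M (length b) (link_type b UNIV)"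
proof -
  interpret swapped: linked_sets E M Q P by (rule swap)
  show "strict_invariant E M (length b) (link_type b UNIV)"
    using link_type_invariant invariant_type_not_forks(1)[OF swapped.link_type_invariant]
      tp_subset_swapped[OF assms]
    unfolding strict_invariant_def indep_f_def by blast
  show "kim_strict_invariant E M (length b) (link_type b UNIV)"
    using link_type_invariant invariant_type_not_forks(2)[OF swapped.link_type_invariant]
      tp_subset_swapped[OF assms]
    unfolding kim_strict_invariant_def indep_K_def by blast
qed

lemma morley_sequence_exists:
  assumes sat: "saturated \<kappa> E" and \<kappa>: "natLeq <o \<kappa>" and M: "countable M"
  obtains s where "morley_sequence E M (length b) (link_type b UNIV) s"
proof -
  have step: "\<exists>a. realizes_restriction E (length b) (link_type b UNIV) A a" if "countable A" for A
  proof -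
    have "|A| <o \<kappa>"
      using that \<kappa> countable_card_le_natLeq ordLeq_ordLess_trans by blast
    then obtain a where "length a = length b" "\<forall>\<theta>\<in>link_type b A. holds E a \<theta>"
      using sat link_type_complete unfolding saturated_def by blast
    then show ?thesis
      by (auto simp: realizes_restriction_def copy_type_restrict)
  qed
  \<comment> \<open>This local predicate hides the name of the set \<open>P\<close> of the locale,
    on which \<open>link_type\<close> still depends. Each term refers to all earlier ones, hence the
    choice principle for well-orders.\<close>
  define P where "P f i a \<longleftrightarrow> realizes_restriction E (length b) (link_type b UNIV)
    (M \<union> (\<Union>j<i. set (f j))) a" for f :: "nat \<Rightarrow> 'a list" and i :: nat and a
  have "\<exists>s. \<forall>i. P s i (s i)"
  proof (rule dependent_wellorder_choice)
    show "P f i a \<longleftrightarrow> P g i a" if "\<And>j. j < i \<Longrightarrow> f j = g j" for f g i a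
    proof -
      have "(\<Union>j<i. set (f j)) = (\<Union>j<i. set (g j))" using that by auto
      then show ?thesis by (simp add: P_def)
    qed
    show "\<exists>a. P f i a" for f i
      unfolding P_def using M by (intro step) (simp add: countable_finite)
  qed
  then show thesis
    using that unfolding morley_sequence_def P_def by blast
qed

end

section \<open>Dividing along two strict invariant types\<close>

definition common_neighbour :: fm where
  "common_neighbour = Conj (Adj 0 1) (Adj 0 2)"

lemma holds_common_neighbour: "holds E [x] (common_neighbour, [y, z]) \<longleftrightarrow> E x y \<and> E x z"
  by (simp add: common_neighbour_def holds_def numeral_2_eq_2)

context linked_sets
begin

lemma link_copy_of_morley:
  assumes "morley_sequence E M (length b) (link_type b UNIV) s"
  shows "link_copy b (M \<union> (\<Union>j<i. set (s j))) (s i)"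
  using assms by (intro link_copy_of_realizes) (simp add: morley_sequence_def)

text \<open>Two instances are already inconsistent: the second entry of \<open>s 1\<close> is a copy
  of \<open>b2\<close>, hence joined to the first entry of \<open>s 0\<close>, which is in
  \<open>Q\<close>. A common solution would complete a triangle.\<close>

lemma divides_along_linked:
  assumes b: "b1 \<notin> M" "b2 \<notin> M" "b1 \<in> Q" "b2 \<in> P"
    and s: "morley_sequence E M (length [b1, b2]) (link_type [b1, b2] UNIV) s"
  shows "divides_along E 1 common_neighbour s"
proof -
  note copy = link_copy_of_morley[OF s]
  note D0 = copy_overD[OF copy[of 0]] and D1 = copy_overD[OF copy[of 1]]
  obtain x1 x2 where x: "s 0 = [x1, x2]"
    using D0(1) by (auto simp: length_Suc_conv)
  obtain y1 y2 where y: "s 1 = [y1, y2]"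
    using D1(1) by (auto simp: length_Suc_conv)
  have "same_over E M x1 b1"
    using D0(4,5)[of 0] b x by (auto simp: same_over_def link_def)
  then have "x1 \<in> Q" using b Q_invariant by blast
  moreover have "x1 \<notin> M" using D0(4)[of 0 x1] b x by auto
  ultimately have "E y2 x1"
    using D1(5)[of 1 x1] b x y by (simp add: link_def lessThan_Suc)
  then have "\<not> (holds E a (common_neighbour, s 0) \<and> holds E a (common_neighbour, s 1))"
    if "length a = 1" for a
    using that no_triangle[of "a ! 0" y2 x1] x y
    by (auto simp: length_Suc_conv holds_common_neighbour)
  then have "\<not> (\<exists>a. length a = 1 \<and>
      (\<forall>\<theta>\<in>{(common_neighbour, s 0), (common_neighbour, s 1)}. holds E a \<theta>))"
    by blast
  moreover have "finite {(common_neighbour, s 0), (common_neighbour, s 1)}"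
      "{(common_neighbour, s 0), (common_neighbour, s 1)} \<subseteq> range (\<lambda>i. (common_neighbour, s i))"
    by auto
  ultimately show ?thesis
    unfolding divides_along_def consistent_def by blast
qed

text \<open>With \<open>P\<close> empty, \<open>link\<close> has no edges outside \<open>M\<close>,
  so different terms are not connected, and within one term the entries mirror \<open>b1\<close> and
  \<open>b2\<close>. As all entries are pairwise non-adjacent, \<open>extension\<close> gives any
  finite number of them a common neighbour.\<close>

lemma not_divides_along_free:
  assumes b: "b1 \<notin> M" "b2 \<notin> M" "\<not> E b1 b2" and "P = {}"
    and s: "morley_sequence E M (length [b1, b2]) (link_type [b1, b2] UNIV) s"
  shows "\<not> divides_along E 1 common_neighbour s"
proof -
  let ?b = "[b1, b2]"
  note copy = link_copy_of_morley[OF s]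
  have b_nth: "?b ! k \<notin> M" if "k < 2" for k
    using b that by (auto simp: less_2_cases_iff)
  have len: "length (s i) = 2" for i using copy_overD(1)[OF copy] by simp
  have s_M: "s i ! k \<notin> M" if "k < 2" for i k
    using copy_overD(4)[OF copy[of i], of k "s i ! k"] b_nth that by auto
  have less: "\<not> E (s i ! k) (s j ! l)" if "j < i" "k < 2" "l < 2" for i j k l
  proof -
    have "s j ! l \<in> M \<union> (\<Union>j<i. set (s j))"
      using that len[of j] by (metis UN_I UnI2 lessThan_iff nth_mem)
    then have "E (s i ! k) (s j ! l) \<longleftrightarrow> link (?b ! k) (s j ! l)"
      using copy_overD(5)[OF copy] that by simp
    then show ?thesis unfolding link_def using s_M that b_nth \<open>P = {}\<close> by simp
  qed
  have same: "\<not> E (s i ! k) (s i ! l)" if "k < 2" "l < 2" for i k l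
  proof -
    have "E (s i ! k) (s i ! l) \<longleftrightarrow> E (?b ! k) (?b ! l)"
      using copy_overD(3)[OF copy] that by simp
    then show ?thesis
      using that b irreflexive adj_commute[of b2 b1] by (auto simp: less_2_cases_iff)
  qed
  have indep: "\<not> E (s i ! k) (s j ! l)" if "k < 2" "l < 2" for i j k l
    using less[of j i k l] less[of i j l k] same[of k l i] that adj_commute[of "s i ! k"]
    by (cases i j rule: linorder_cases) auto
  have "\<exists>a. length a = 1 \<and> (\<forall>\<theta>\<in>F. holds E a \<theta>)"
    if F: "finite F" "F \<subseteq> range (\<lambda>i. (common_neighbour, s i))" for F
  proof -
    obtain K where K: "finite K" "F = (\<lambda>i. (common_neighbour, s i)) ` K"
      using finite_subset_image[OF F] by blast
    define X where "X = (\<Union>i\<in>K. {s i ! 0, s i ! 1})"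
    have "\<exists>z\<in>UNIV. z \<notin> X \<union> {} \<and> (\<forall>x\<in>X. E z x) \<and> (\<forall>x\<in>{}. \<not> E z x)"
    proof (rule extension)
      show "\<not> E x y" if "x \<in> X" "y \<in> X" for x y
        using that indep unfolding X_def by auto
    qed (use K in \<open>auto simp: X_def\<close>)
    then obtain z where z: "\<And>x. x \<in> X \<Longrightarrow> E z x" by blast
    have "holds E [z] (common_neighbour, s i)" if "i \<in> K" for i
    proof -
      have "s i = [s i ! 0, s i ! 1]"
        using len[of i] by (auto simp: length_Suc_conv numeral_2_eq_2)
      moreover have "E z (s i ! 0)" "E z (s i ! 1)"
        using z that by (auto simp: X_def)
      ultimately show ?thesis using holds_common_neighbour by metis
    qed
    then show ?thesis using K(2) by (intro exI[of _ "[z]"]) simp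
  qed
  then show ?thesis unfolding divides_along_def consistent_def by blast
qed

end

text \<open>By quantifier elimination the elements of this set share one type over
  \<open>M\<close>.\<close>

definition sole_neighbour :: "('a \<Rightarrow> 'a \<Rightarrow> bool) \<Rightarrow> 'a set \<Rightarrow> 'a \<Rightarrow> 'a set" where
  "sole_neighbour E M m = {x. x \<notin> M \<and> (\<forall>y\<in>M. E x y \<longleftrightarrow> y = m)}"

context generic_universe
begin

lemma linked_sets_sole_neighbour:
  assumes m: "m1 \<in> M" "m2 \<in> M" "m1 \<noteq> m2"
  shows "linked_sets E M (sole_neighbour E M m1) (sole_neighbour E M m2)"
proof -
  have indep: "\<not> E x y" if "m \<in> M" "x \<in> sole_neighbour E M m" "y \<in> sole_neighbour E M m" for m x y
    using that no_triangle[of x y m] by (auto simp: sole_neighbour_def)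
  have inv: "x \<in> sole_neighbour E M m \<longleftrightarrow> y \<in> sole_neighbour E M m" if "same_over E M x y" for m x y
  proof -
    have "x \<in> M \<longleftrightarrow> y \<in> M" using that unfolding same_over_def by metis
    then show ?thesis using that by (simp add: sole_neighbour_def same_over_def)
  qed
  show ?thesis
  proof
    show "\<not> E y z" if "z \<in> M" "x \<in> sole_neighbour E M m1" "y \<in> sole_neighbour E M m2" "E x z" for x y z
      using that m by (auto simp: sole_neighbour_def)
    show "\<not> E x y" if "x \<in> sole_neighbour E M m1" "y \<in> sole_neighbour E M m1" for x y
      by (rule indep[OF m(1) that])
    show "\<not> E x y" if "x \<in> sole_neighbour E M m2" "y \<in> sole_neighbour E M m2" for x y
      by (rule indep[OF m(2) that])
  qed (fact inv)+
qed

lemma sole_neighbours_exist: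
  assumes sat: "saturated \<kappa> E" and M: "|M| <o \<kappa>" and m: "m1 \<noteq> m2"
  obtains b1 b2 where "b1 \<in> sole_neighbour E M m1" "b2 \<in> sole_neighbour E M m2" "\<not> E b1 b2"
proof -
  \<comment> \<open>\<open>u\<close> and \<open>v\<close> are only a pattern for the pair, distinct
    and non-adjacent; \<open>N\<close> prescribes the neighbours of their copies.\<close>
  obtain u v where uv: "u \<noteq> v" "\<not> E u v"
    using extension[of "{}" "{m1}"] by auto
  define N where "N d x \<longleftrightarrow> x = (if d = u then m1 else m2)" for d x
  \<comment> \<open>The empty set in place of \<open>M\<close> makes the copies differ from all
    parameters.\<close>
  have ex: "\<exists>a. copy_over E [u, v] (\<lambda>d x. d = x \<and> d \<in> {}) N C a" if "finite C" for C
  proof (rule copy_exists[OF that])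
    show "\<not> E x y" if "N d x" "N d y" for d x y
      using that irreflexive by (simp add: N_def)
    show "\<not> N e x" if "d \<in> set [u, v]" "e \<in> set [u, v]" "E d e" for d e x
      using that uv irreflexive adj_commute[of v u] by auto
  qed simp
  obtain b where "length b = length [u, v]"
      "\<forall>\<theta>\<in>copy_type E [u, v] (\<lambda>d x. d = x \<and> d \<in> {}) N M. holds E b \<theta>"
    using sat complete_copy_type[OF ex] M unfolding saturated_def by blast
  then have "copy_over E [u, v] (\<lambda>d x. d = x \<and> d \<in> {}) N M b"
    using ex by (intro copy_over_of_realizes) blast+
  note D = copy_overD[OF this]
  obtain b1 b2 where b: "b = [b1, b2]"
    using D(1) by (auto simp: length_Suc_conv)
  have "\<not> E b1 b2" using D(3)[of 0 1] uv b by simp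
  moreover have "b1 \<in> sole_neighbour E M m1"
    using D(4,5)[of 0] b by (auto simp: N_def sole_neighbour_def)
  moreover have "b2 \<in> sole_neighbour E M m2"
    using D(4,5)[of 1] b uv by (auto simp: N_def sole_neighbour_def)
  ultimately show thesis using that by blast
qed

end

theorem theorem4p12:
  fixes H :: "'h \<Rightarrow> 'h \<Rightarrow> bool"
    and E :: "'a \<Rightarrow> 'a \<Rightarrow> bool"
    and \<kappa> :: "'k rel"
  assumes "henson_graph UNIV H"
    and "monster_model \<kappa> (theory_of UNIV H) E"
  shows "(\<exists>M n \<phi> b. small_model \<kappa> E M \<and> models M E (theory_of UNIV H) \<and>
            (\<phi>, b) \<in> formulas_over n UNIV \<and>
            strictly_divides E M n (\<phi>, b) \<and>
            \<not> universally_strictly_divides E M n (\<phi>, b)) \<and>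
         \<not> new_kims_lemma \<kappa> E"
proof -
  have T: "models UNIV E (theory_of UNIV H)" and sat: "saturated \<kappa> E" and \<kappa>: "natLeq <o \<kappa>"
    using assms(2) by (auto simp: monster_model_def)
  have gen: "generic_triangle_free UNIV E"
    using T henson_graph_generic[OF assms(1)] by (rule generic_of_models)
  interpret generic_universe E by (simp add: generic_universe_def gen)
  \<comment> \<open>\<open>\<kappa>\<close> is only known to be uncountable, so a countable
    \<open>M\<close> keeps all parameter sets of the Morley sequences small.\<close>
  obtain M where M: "countable M" "generic_triangle_free M E"
    using countable_generic_subset[OF gen] by blast
  have card_M: "|M| <o \<kappa>"
    using M(1) \<kappa> countable_card_le_natLeq ordLeq_ordLess_trans by blast
  then have small: "small_model \<kappa> E M"
    using elem_sub_of_generic[OF M(2) gen] by (simp add: small_model_def)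
  then have M_models: "models M E (theory_of UNIV H)"
    using T unfolding small_model_def elem_sub_def models_def by blast
  obtain m1 m2 where m: "m1 \<in> M" "m2 \<in> M" "m1 \<noteq> m2"
  proof -
    obtain x where x: "x \<in> M" using small by (auto simp: small_model_def elem_sub_def)
    then obtain y where "y \<in> M" "y \<noteq> x"
      using generic_triangle_free.extension[OF M(2), of "{}" "{x}"] by auto
    then show thesis using that x by blast
  qed
  obtain b1 b2 where b: "b1 \<in> sole_neighbour E M m1" "b2 \<in> sole_neighbour E M m2" "\<not> E b1 b2"
    using sole_neighbours_exist[OF sat card_M m(3)] by blast
  then have b_M: "b1 \<notin> M" "b2 \<notin> M" "set [b1, b2] \<inter> M = {}"
    by (auto simp: sole_neighbour_def)
  \<comment> \<open>The order is reversed: copies of \<open>b2\<close> send the new edges, so its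
    class plays the role of \<open>P\<close> and that of \<open>b1\<close> the role of
    \<open>Q\<close>.\<close>
  interpret linked: linked_sets E M "sole_neighbour E M m2" "sole_neighbour E M m1"
    using m by (intro linked_sets_sole_neighbour) auto
  interpret free: linked_sets E M "{}" "{}"
    by unfold_locales auto
  have fm: "(common_neighbour, [b1, b2]) \<in> formulas_over 1 UNIV"
    by (auto simp: common_neighbour_def formulas_over_def)
  obtain s where s: "morley_sequence E M (length [b1, b2]) (linked.link_type [b1, b2] UNIV) s"
    using linked.morley_sequence_exists[OF sat \<kappa> M(1)] by blast
  have "divides_along E 1 common_neighbour s"
    using linked.divides_along_linked[OF b_M(1,2) b(1,2) s] .
  \<comment> \<open>One sequence serves both notions, since the strict linked type is in particular
    an invariant extension of the type of the pair.\<close>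
  then have sdiv: "strictly_divides E M 1 (common_neighbour, [b1, b2])"
      and kdiv: "kim_divides E M 1 (common_neighbour, [b1, b2])"
    using s linked.link_type_strict(1)[OF b_M(3)] linked.link_type_invariant[of "[b1, b2]"]
      linked.tp_base_subset_link_type[of "[b1, b2]"]
    unfolding strictly_divides_def kim_divides_def prod.case by blast+
  obtain t where t: "morley_sequence E M (length [b1, b2]) (free.link_type [b1, b2] UNIV) t"
    using free.morley_sequence_exists[OF sat \<kappa> M(1)] by blast
  have not_div: "\<not> divides_along E 1 common_neighbour t"
    using free.not_divides_along_free[OF b_M(1,2) b(3) refl t] .
  then have "\<not> universally_strictly_divides E M 1 (common_neighbour, [b1, b2])"
    using t free.link_type_strict(1)[OF b_M(3)] free.tp_base_subset_link_type[of "[b1, b2]"]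
    unfolding universally_strictly_divides_def prod.case by blast
  \<comment> \<open>The free type is Kim-strict as well, so the sequence \<open>t\<close> also
    refutes the Kim variant.\<close>
  moreover have "\<not> universally_kim_strictly_divides E M 1 (common_neighbour, [b1, b2])"
    using not_div t free.link_type_strict(2)[OF b_M(3)] free.tp_base_subset_link_type[of "[b1, b2]"]
    unfolding universally_kim_strictly_divides_def prod.case by blast
  then have "\<not> new_kims_lemma \<kappa> E"
    using small fm kdiv unfolding new_kims_lemma_def by blast
  ultimately show ?thesis
    using small M_models fm sdiv by blast
qed

end
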